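(* Let $f$ be a real symmetric function on pairs of positive integers and let $(a_1,\dots,a_N)$ be a sequence of compressed actions. Apply Algorithm 1 to $(a_1,\dots,a_N)$, expand the output into an (uncompressed) action sequence $(b_1,\dots,b_{n-2})$ by replacing each $ST$ by $SC,CS,TT$ and each $CT$ by $CC,CS,TT$, and apply Algorithm 2 to obtain a link sequence $(1,1,L_3,\dots,L_n)$. Then $(1,1,L_3,\dots,L_n)$ is globally realizable (it is realized by a general polyomino chain with $n$ squares), and $TI_f$ of this general polyomino chain equals the value $TI_f((a_1,\dots,a_N))$ of the initial compressed action sequence.
   Context: Degree-based index: for a graph $G$, $TI_f(G)=\sum_{uv\in E(G)} f(d_u,d_v)$ with $f$ symmetric. General polyomino chains and links: a polyomino system is a finite 2-connected planar graph whose interior faces are unit squares; a general polyomino chain is one whose inner dual (cells adjacent iff sharing an edge) is a path, built by gluing squares $1,2,\dots,n$ successively, square $i+1$ along a side of square $i$. Square 1 is placed, square 2 to its right. A square $i\ge2$ is horizontal/vertical according as it is attached left/right or above/below square $i-1$, with orientation in $\{R,L,U,D\}$. Links $L_1=L_2=1$ and for $i\ge2$: $L_{i+1}=1$ if square $i+1$ has the same direction as square $i$; otherwise, with $j=\max\{1<\ell<i:$ direction of square $\ell\ne$ direction of square $i\}$, $L_{i+1}=2$ if $j$ does not exist or the orientation of square $i+1$ equals that of square $j$, and $L_{i+1}=3$ otherwise. A link sequence is globally realizable if the construction yields a general polyomino chain. Local contributions: $g_f(SS)=3f(3,3)$; $g_f(SC)=3f(3,4)+f(2,4)+f(2,3)-2f(3,3)$;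 $g_f(CS)=f(3,4)-f(2,4)+f(2,3)+2f(3,3)$; $g_f(CC)=f(4,4)+2f(2,4)$; $g_f(TT)=f(2,3)+f(2,4)+f(3,4)+f(4,4)-f(3,3)$; $g_f(ST)=g_f(SC)+g_f(CS)+g_f(TT)$; $g_f(CT)=g_f(CC)+g_f(CS)+g_f(TT)$. Compressed actions: a sequence of compressed actions is $(a_1,\dots,a_N)$ with $a_i\in\{SS,SC,CS,CC,ST,CT\}$; write $F_i\in\{S,C\}$ for the first letter and $S_i\in\{S,C,T\}$ for the second letter of $a_i$. Constraints: $a_1\in\{SS,SC,ST\}$; if $S_i=S$ then $F_{i+1}=S$; if $S_i\in\{C,T\}$ then $F_{i+1}=C$. The number of squares is $n=2+\#\{i: a_i\in\{SS,SC,CS,CC\}\}+3\#\{i:a_i\in\{ST,CT\}\}$. Its value is $TI_f((a_1,\dots,a_N))=c(a_1)+\sum_{i=2}^N g_f(a_i)$, where $c(SS)=2f(2,2)+4f(2,3)+4f(3,3)$, $c(SC)=2f(2,2)+4f(2,3)+2f(3,4)+2f(2,4)$, $c(ST)=c(SC)+g_f(CS)+g_f(TT)$. Algorithm 1 (parity correction): set $m\gets0$; for $i=1,\dots,N$: if $a_i\in\{SC,CC\}$ then $m\gets m+1$; if $a_i\in\{ST,CT\}$ then $m\gets m+2$; if $S_i=T$ and $m$ is odd, let $j=\max\{j<i: S_j=C\}$ (current letters) and replace $a_j$ by $F_jT$ and $a_i$ by $F_iC$. Algorithm 2 (actions to links): given an uncompressed action sequence $(b_1,\dots,b_{n-2})$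 over $\{SS,SC,CS,CC,TT\}$, set $L_1=L_2=1$ and for $i=1,\dots,n-2$: $L_{i+2}=3$ if $b_i=TT$; else $L_{i+2}=1$ if the second letter of $b_i$ is $S$; else $L_{i+2}=2$. The first two squares are placed on a horizontal line. *)

theory Defs
  imports "HOL-Analysis.Analysis"
begin

section \<open>Degree-based indices of finite simple graphs\<close>

text \<open>A graph without isolated vertices is given by its set of edges, which are two-element sets.\<close>

definition degree :: "'v set set \<Rightarrow> 'v \<Rightarrow> nat" where
  "degree E u = card {e \<in> E. u \<in> e}"

text \<open>For symmetric \<open>f\<close> the term \<open>f d\<^sub>u d\<^sub>v\<close> does not depend on how the edge is
  written as \<open>{u, v}\<close>, so the description below denotes it.\<close>

definition TI :: "(nat \<Rightarrow> nat \<Rightarrow> real) \<Rightarrow> 'v set set \<Rightarrow> real" where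
  "TI f E = (\<Sum>e\<in>E. THE r. \<exists>u v. e = {u, v} \<and> r = f (degree E u) (degree E v))"

definition graph_connected :: "'v set \<Rightarrow> 'v set set \<Rightarrow> bool" where
  "graph_connected V E \<longleftrightarrow> (\<forall>u\<in>V. \<forall>v\<in>V. (u, v) \<in> {(x, y). {x, y} \<in> E}\<^sup>*)"

definition two_connected :: "'v set \<Rightarrow> 'v set set \<Rightarrow> bool" where
  "two_connected V E \<longleftrightarrow> 3 \<le> card V \<and> graph_connected V E \<and>
     (\<forall>v\<in>V. graph_connected (V - {v}) {e \<in> E. v \<notin> e})"


section \<open>Polyomino systems and general polyomino chains\<close>

text \<open>Unit squares glued side to side lie on a common square lattice. A lattice square is
  named by its lower left corner.\<close>

type_synonym point = "int \<times> int"
type_synonym cell = "int \<times> int"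

fun sides :: "cell \<Rightarrow> point set set" where
  "sides (x, y) = {{(x, y), (x + 1, y)}, {(x, y + 1), (x + 1, y + 1)},
                   {(x, y), (x, y + 1)}, {(x + 1, y), (x + 1, y + 1)}}"

fun unit_square :: "cell \<Rightarrow> (real \<times> real) set" where
  "unit_square (x, y) =
     {real_of_int x <..< real_of_int x + 1} \<times> {real_of_int y <..< real_of_int y + 1}"

definition embed :: "point \<Rightarrow> real \<times> real" where
  "embed p = (real_of_int (fst p), real_of_int (snd p))"

text \<open>For an edge \<open>e = {p, q}\<close> the convex hull is the straight segment from \<open>p\<close> to \<open>q\<close>.\<close>

definition drawing :: "point set set \<Rightarrow> (real \<times> real) set" where
  "drawing E = (\<Union>e\<in>E. convex hull (embed ` e))"

definition interior_faces :: "point set set \<Rightarrow> (real \<times> real) set set" where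
  "interior_faces E = {F \<in> components (- drawing E). bounded F}"

definition polyomino_system :: "point set set \<Rightarrow> bool" where
  "polyomino_system E \<longleftrightarrow> finite E \<and> E \<subseteq> (\<Union>c. sides c) \<and> two_connected (\<Union>E) E \<and>
     interior_faces E \<subseteq> range unit_square"

text \<open>Squares are numbered from 1.\<close>

definition sq :: "cell list \<Rightarrow> nat \<Rightarrow> cell" where
  "sq cs i = cs ! (i - 1)"

definition chain_edges :: "cell list \<Rightarrow> point set set" where
  "chain_edges cs = (\<Union>c\<in>set cs. sides c)"

text \<open>The list is an enumeration of the interior faces along the inner dual path. The condition on
  the interior faces excludes chains that close up around a hole (for instance by
  touching themselves at a corner).\<close>

definition general_polyomino_chain :: "cell list \<Rightarrow> bool" where
  "general_polyomino_chain cs \<longleftrightarrow>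
     polyomino_system (chain_edges cs) \<and>
     interior_faces (chain_edges cs) = unit_square ` set cs \<and>
     distinct cs \<and>
     (\<forall>i\<in>{1..length cs}. \<forall>j\<in>{1..length cs}. i \<noteq> j \<longrightarrow>
        (sides (sq cs i) \<inter> sides (sq cs j) \<noteq> {} \<longleftrightarrow> j = i + 1 \<or> i = j + 1))"


section \<open>Links\<close>

datatype orientation = Rightwards | Leftwards | Upwards | Downwards

fun attach :: "orientation \<Rightarrow> cell \<Rightarrow> cell" where
  "attach Rightwards (x, y) = (x + 1, y)"
| "attach Leftwards (x, y) = (x - 1, y)"
| "attach Upwards (x, y) = (x, y + 1)"
| "attach Downwards (x, y) = (x, y - 1)"

datatype direction = Horizontal | Vertical

fun direction_of :: "orientation \<Rightarrow> direction" where
  "direction_of Rightwards = Horizontal"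
| "direction_of Leftwards = Horizontal"
| "direction_of Upwards = Vertical"
| "direction_of Downwards = Vertical"

text \<open>Orientation and direction of square \<open>i\<close>, meaningful for \<open>i \<ge> 2\<close>.\<close>

definition orient :: "cell list \<Rightarrow> nat \<Rightarrow> orientation" where
  "orient cs i = (THE d. sq cs i = attach d (sq cs (i - 1)))"

definition dir :: "cell list \<Rightarrow> nat \<Rightarrow> direction" where
  "dir cs i = direction_of (orient cs i)"

text \<open>\<open>link cs k\<close> is the link of square \<open>k\<close>; the general case is \<open>k = i + 1\<close> with \<open>i \<ge> 2\<close>.\<close>

definition link :: "cell list \<Rightarrow> nat \<Rightarrow> nat" where
  "link cs k =
     (if k \<le> 2 then 1
      else let i = k - 1; J = {l. 1 < l \<and> l < i \<and> dir cs l \<noteq> dir cs i} in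
        if dir cs (i + 1) = dir cs i then 1
        else if J = {} \<or> orient cs (i + 1) = orient cs (Max J) then 2
        else 3)"

text \<open>Only the position of square 1 and, at the first vertical square, the choice between above
  and below are not determined by the links.\<close>

definition realizes :: "cell list \<Rightarrow> nat list \<Rightarrow> bool" where
  "realizes cs ls \<longleftrightarrow>
     general_polyomino_chain cs \<and>
     (2 \<le> length cs \<longrightarrow> sq cs 2 = attach Rightwards (sq cs 1)) \<and>
     ls = map (link cs) [1..<length cs + 1]"

definition globally_realizable :: "nat list \<Rightarrow> bool" where
  "globally_realizable ls \<longleftrightarrow> (\<exists>cs. realizes cs ls)"


section \<open>Actions\<close>

datatype letter = S | C | T

type_synonym action = "letter \<times> letter"

abbreviation "SS \<equiv> (S, S)"
abbreviation "SC \<equiv> (S, C)"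
abbreviation "CS \<equiv> (C, S)"
abbreviation "CC \<equiv> (C, C)"
abbreviation "TT \<equiv> (T, T)"
abbreviation "ST \<equiv> (S, T)"
abbreviation "CT \<equiv> (C, T)"

text \<open>The pairs \<open>(T, S)\<close> and \<open>(T, C)\<close> are not actions.\<close>

fun g_basic :: "(nat \<Rightarrow> nat \<Rightarrow> real) \<Rightarrow> action \<Rightarrow> real" where
  "g_basic f SS = 3 * f 3 3"
| "g_basic f SC = 3 * f 3 4 + f 2 4 + f 2 3 - 2 * f 3 3"
| "g_basic f CS = f 3 4 - f 2 4 + f 2 3 + 2 * f 3 3"
| "g_basic f CC = f 4 4 + 2 * f 2 4"
| "g_basic f TT = f 2 3 + f 2 4 + f 3 4 + f 4 4 - f 3 3"

definition g :: "(nat \<Rightarrow> nat \<Rightarrow> real) \<Rightarrow> action \<Rightarrow> real" where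
  "g f a =
     (if a = ST then g_basic f SC + g_basic f CS + g_basic f TT
      else if a = CT then g_basic f CC + g_basic f CS + g_basic f TT
      else g_basic f a)"

fun c_init :: "(nat \<Rightarrow> nat \<Rightarrow> real) \<Rightarrow> action \<Rightarrow> real" where
  "c_init f SS = 2 * f 2 2 + 4 * f 2 3 + 4 * f 3 3"
| "c_init f SC = 2 * f 2 2 + 4 * f 2 3 + 2 * f 3 4 + 2 * f 2 4"
| "c_init f ST = (2 * f 2 2 + 4 * f 2 3 + 2 * f 3 4 + 2 * f 2 4) + g f CS + g f TT"

definition compressed_sequence :: "action list \<Rightarrow> bool" where
  "compressed_sequence as \<longleftrightarrow>
     as \<noteq> [] \<and> set as \<subseteq> {SS, SC, CS, CC, ST, CT} \<and> hd as \<in> {SS, SC, ST} \<and>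
     (\<forall>i. i + 1 < length as \<longrightarrow>
        (snd (as ! i) = S \<longrightarrow> fst (as ! (i + 1)) = S) \<and>
        (snd (as ! i) \<in> {C, T} \<longrightarrow> fst (as ! (i + 1)) = C))"

definition num_squares :: "action list \<Rightarrow> nat" where
  "num_squares as =
     2 + length (filter (\<lambda>a. a \<in> {SS, SC, CS, CC}) as)
       + 3 * length (filter (\<lambda>a. a \<in> {ST, CT}) as)"

definition action_value :: "(nat \<Rightarrow> nat \<Rightarrow> real) \<Rightarrow> action list \<Rightarrow> real" where
  "action_value f as = c_init f (hd as) + (\<Sum>a\<leftarrow>tl as. g f a)"

text \<open>Parity correction. One pass of the loop body acts on the state \<open>(m, as)\<close>; indices are
  0-based here. Whenever \<open>Max\<close> is reached from a compressed sequence, its argument is nonempty: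
  an odd \<open>m\<close> forces an earlier second letter \<open>C\<close>.\<close>

fun parity_step :: "nat \<Rightarrow> nat \<times> action list \<Rightarrow> nat \<times> action list" where
  "parity_step i (m, as) =
     (let m' = m + (if as ! i \<in> {SC, CC} then 1 else 0) + (if as ! i \<in> {ST, CT} then 2 else 0)
      in if snd (as ! i) = T \<and> odd m'
         then let j = Max {j. j < i \<and> snd (as ! j) = C}
              in (m', as[j := (fst (as ! j), T), i := (fst (as ! i), C)])
         else (m', as))"

definition parity_correction :: "action list \<Rightarrow> action list" where
  "parity_correction as = snd (fold parity_step [0..<length as] (0, as))"

definition expand :: "action list \<Rightarrow> action list" where
  "expand as = concat (map (\<lambda>a. if a = ST then [SC, CS, TT]
                                 else if a = CT then [CC, CS, TT] else [a]) as)"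

definition actions_to_links :: "action list \<Rightarrow> nat list" where
  "actions_to_links bs =
     [1, 1] @ map (\<lambda>b. if b = TT then 3 else if snd b = S then 1 else 2) bs"

end

(* A chain is a walk of orientations. Parity correction makes every T act when the current square is
   horizontal, so that the U-turn it produces consists of two vertical steps and a horizontal step
   back. All vertical steps then have the same orientation, and the chain drifts away from what was
   built before: each square is attached as an ear with two fresh vertices, every horizontal slice
   of the chain is an interval, and the chain is determined by its links up to translation and
   reflection. The index changes only at the edges meeting the two end vertices of an ear, and the
   degrees there depend only on whether the last steps were straight, a zigzag or a U-turn; this
   gives the local contributions. Parity correction itself exchanges a C and a T, which preserves
   the value because g(FT) - g(FC) does not depend on F. *)
theory Submission imports Defs begin

section \<open>Ears of graphs\<close>

text \<open>A link fixes a turn only relative to earlier orientations, so a realization may climb or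
  descend, and the claim concerns every realization. Hence the vertical orientation \<open>v\<close>
  stays a parameter of the statements on degrees and links; only existence is settled for
  \<open>Upwards\<close> alone. A T performed after a vertical step would reverse the vertical
  orientation and send the walk back towards occupied rows, where it may meet earlier squares. With
  a horizontal U-turn the strip walked back lies two rows further on, and rows two apart share no
  vertex. So new vertices need only be compared with the current row and the row before it, and an
  invariant about these two rows suffices. The parity that matters at a T is that of the number of
  changes of direction so far: C is one change, T (expanded into a C, an S and a T) is two, S is
  none.\<close>

definition nbrs :: "'v set set \<Rightarrow> 'v \<Rightarrow> 'v set" where
  "nbrs E u = {x. {u, x} \<in> E}"

definition simple_graph :: "'v set set \<Rightarrow> bool" where
  "simple_graph E \<longleftrightarrow> finite E \<and> (\<forall>e\<in>E. card e = 2)"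

text \<open>Symmetry is available at positive arguments only. An end of an edge has positive degree,
  so the description inside \<open>TI\<close> still denotes, as \<open>edge_value_eq\<close>
  shows.\<close>

definition sym_pos :: "(nat \<Rightarrow> nat \<Rightarrow> real) \<Rightarrow> bool" where
  "sym_pos f \<longleftrightarrow> (\<forall>x\<ge>1. \<forall>y\<ge>1. f x y = f y x)"

definition edge_value :: "(nat \<Rightarrow> nat \<Rightarrow> real) \<Rightarrow> 'v set set \<Rightarrow> 'v set \<Rightarrow> real" where
  "edge_value f E e = (THE r. \<exists>u v. e = {u, v} \<and> r = f (degree E u) (degree E v))"

lemma TI_edge_value: "TI f E = (\<Sum>e\<in>E. edge_value f E e)"
  unfolding TI_def edge_value_def ..

lemma degree_nbrs:
  assumes "simple_graph E"
  shows "degree E u = card (nbrs E u)"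
proof -
  have "{e \<in> E. u \<in> e} = (\<lambda>x. {u, x}) ` nbrs E u"
  proof (intro set_eqI iffI)
    fix e assume e: "e \<in> {e \<in> E. u \<in> e}"
    then have "card e = 2" using assms by (auto simp: simple_graph_def)
    then obtain a b where "e = {a, b}" by (auto simp: card_2_iff)
    with e show "e \<in> (\<lambda>x. {u, x}) ` nbrs E u"
      by (auto simp: nbrs_def insert_commute image_iff)
  qed (auto simp: nbrs_def)
  moreover have "inj_on (\<lambda>x. {u, x}) (nbrs E u)"
    by (auto simp: inj_on_def doubleton_eq_iff)
  ultimately show ?thesis unfolding degree_def by (simp add: card_image)
qed

lemma nbrs_irrefl: "simple_graph E \<Longrightarrow> u \<notin> nbrs E u"
  by (auto simp: simple_graph_def nbrs_def)

lemma nbrs_in_vertices: "x \<in> nbrs E u \<Longrightarrow> x \<in> \<Union>E \<and> u \<in> \<Union>E"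
  by (auto simp: nbrs_def)

lemma degree_pos:
  assumes "simple_graph E" "u \<in> \<Union>E"
  shows "1 \<le> degree E u"
proof -
  have "{e \<in> E. u \<in> e} \<noteq> {}" "finite {e \<in> E. u \<in> e}"
    using assms by (auto simp: simple_graph_def)
  then show ?thesis unfolding degree_def by (simp add: card_gt_0_iff Suc_le_eq)
qed

lemma edge_value_eq:
  assumes f: "sym_pos f" and E: "simple_graph E" and e: "{u, v} \<in> E"
  shows "edge_value f E {u, v} = f (degree E u) (degree E v)"
proof -
  have "1 \<le> degree E u" "1 \<le> degree E v" using degree_pos[OF E, of u] degree_pos[OF E, of v] e by (auto simp del: One_nat_def)
  then show ?thesis unfolding edge_value_def
    by (intro the_equality) (use f in \<open>auto simp: sym_pos_def doubleton_eq_iff\<close>)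
qed

definition ear :: "'v set set \<Rightarrow> 'v \<Rightarrow> 'v \<Rightarrow> 'v \<Rightarrow> 'v \<Rightarrow> 'v set set" where
  "ear E p q u w = E \<union> {{p, u}, {u, w}, {w, q}}"

context
  fixes E :: "'v set set" and p q u w :: 'v
  assumes E: "simple_graph E" and pq: "{p, q} \<in> E"
    and fresh: "u \<notin> \<Union>E" "w \<notin> \<Union>E" "u \<noteq> w"
begin

lemma ear_distinct: "p \<noteq> q" "p \<noteq> u" "p \<noteq> w" "q \<noteq> u" "q \<noteq> w"
  using E pq fresh by (auto simp: simple_graph_def)

lemma simple_graph_ear: "simple_graph (ear E p q u w)"
  using E ear_distinct fresh(3) by (auto simp: simple_graph_def ear_def)

lemma nbrs_ear_left: "nbrs (ear E p q u w) p = insert u (nbrs E p)"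
  using ear_distinct fresh by (auto simp: nbrs_def ear_def doubleton_eq_iff)

lemma nbrs_ear_right: "nbrs (ear E p q u w) q = insert w (nbrs E q)"
  using ear_distinct fresh by (auto simp: nbrs_def ear_def doubleton_eq_iff)

lemma nbrs_ear_new_left: "nbrs (ear E p q u w) u = {p, w}"
  using ear_distinct fresh by (auto simp: nbrs_def ear_def doubleton_eq_iff)

lemma nbrs_ear_new_right: "nbrs (ear E p q u w) w = {q, u}"
  using ear_distinct fresh by (auto simp: nbrs_def ear_def doubleton_eq_iff)

lemma nbrs_ear_other: "x \<in> \<Union>E \<Longrightarrow> x \<noteq> p \<Longrightarrow> x \<noteq> q \<Longrightarrow> nbrs (ear E p q u w) x = nbrs E x"
  using ear_distinct fresh by (auto simp: nbrs_def ear_def doubleton_eq_iff)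

text \<open>Among the old vertices only \<open>p\<close> and \<open>q\<close> change their degrees,
  each by one. So the old edges whose value changes are \<open>{p, q}\<close> and those from
  \<open>p\<close> to \<open>X\<close> or from \<open>q\<close> to \<open>Y\<close>, whose other
  ends keep their degrees. Along the path \<open>p\<close>, \<open>u\<close>, \<open>w\<close>,
  \<open>q\<close> of new edges the degrees are \<open>card X + 2\<close>, 2, 2,
  \<open>card Y + 2\<close>.\<close>

lemma TI_ear:
  assumes f: "sym_pos f"
    and p: "nbrs E p = insert q X" "q \<notin> X" "finite X"
    and q: "nbrs E q = insert p Y" "p \<notin> Y" "finite Y"
  shows "TI f (ear E p q u w) = TI f E + f 2 2 + f (card X + 2) 2 + f (card Y + 2) 2
    + f (card X + 2) (card Y + 2) - f (card X + 1) (card Y + 1)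
    + (\<Sum>x\<in>X. f (card X + 2) (degree E x) - f (card X + 1) (degree E x))
    + (\<Sum>y\<in>Y. f (card Y + 2) (degree E y) - f (card Y + 1) (degree E y))"
proof -
  let ?E = "ear E p q u w"
  note nb = nbrs_ear_left nbrs_ear_right nbrs_ear_new_left nbrs_ear_new_right nbrs_ear_other
  note deg = degree_nbrs[OF E] degree_nbrs[OF simple_graph_ear]
  have X: "x \<in> \<Union>E \<and> x \<noteq> p \<and> x \<noteq> q \<and> {p, x} \<in> E" if "x \<in> X" for x
    using that p nbrs_in_vertices[of x E p] nbrs_irrefl[OF E, of p] by (auto simp: nbrs_def)
  have Y: "x \<in> \<Union>E \<and> x \<noteq> p \<and> x \<noteq> q \<and> {q, x} \<in> E" if "x \<in> Y" for x
    using that q nbrs_in_vertices[of x E q] nbrs_irrefl[OF E, of q] by (auto simp: nbrs_def)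
  have uX: "u \<notin> insert q X" "w \<notin> insert p Y"
    using X Y fresh ear_distinct by blast+
  have dp: "degree E p = card X + 1" "degree ?E p = card X + 2"
    using uX p by (simp_all add: deg nb)
  have dq: "degree E q = card Y + 1" "degree ?E q = card Y + 2"
    using uX q by (simp_all add: deg nb)
  have du: "degree ?E u = 2" "degree ?E w = 2"
    using ear_distinct by (simp_all add: deg nb)
  have same: "degree ?E x = degree E x" if "x \<in> \<Union>E" "x \<noteq> p" "x \<noteq> q" for x
    using that by (simp add: deg nb)
  let ?h = "\<lambda>e. edge_value f ?E e - edge_value f E e"
  let ?N = "{{p, u}, {u, w}, {w, q}}"
  let ?A = "insert {p, q} ((\<lambda>x. {p, x}) ` X \<union> (\<lambda>y. {q, y}) ` Y)"
  have fE: "finite E" using E by (simp add: simple_graph_def)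
  have ev: "edge_value f ?E {a, b} = f (degree ?E a) (degree ?E b)" if "{a, b} \<in> ?E" for a b
    by (rule edge_value_eq[OF f simple_graph_ear that])
  have ev0: "edge_value f E {a, b} = f (degree E a) (degree E b)" if "{a, b} \<in> E" for a b
    by (rule edge_value_eq[OF f E that])
  have sub: "E \<subseteq> ?E" by (auto simp: ear_def)
  have "E \<inter> ?N = {}" using fresh by auto
  then have "TI f ?E = (\<Sum>e\<in>E. edge_value f ?E e) + (\<Sum>e\<in>?N. edge_value f ?E e)"
    unfolding TI_edge_value ear_def by (intro sum.union_disjoint) (use fE in auto)
  also have "(\<Sum>e\<in>?N. edge_value f ?E e)
      = edge_value f ?E {p, u} + edge_value f ?E {u, w} + edge_value f ?E {w, q}"
    using ear_distinct fresh(3) by (simp add: doubleton_eq_iff)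
  also have "\<dots> = f (card X + 2) 2 + f 2 2 + f (card Y + 2) 2"
  proof -
    have "f 2 (card Y + 2) = f (card Y + 2) 2" using f by (simp add: sym_pos_def)
    moreover have "{p, u} \<in> ?E" "{u, w} \<in> ?E" "{w, q} \<in> ?E" by (auto simp: ear_def)
    ultimately show ?thesis by (simp add: ev dp dq du)
  qed
  also have "(\<Sum>e\<in>E. edge_value f ?E e) = TI f E + (\<Sum>e\<in>E. ?h e)"
    by (simp add: TI_edge_value sum_subtractf)
  also have "(\<Sum>e\<in>E. ?h e) = (\<Sum>e\<in>?A. ?h e)"
  proof (rule sum.mono_neutral_right[OF fE])
    show "?A \<subseteq> E" using pq X Y by auto
    show "\<forall>e\<in>E - ?A. ?h e = 0"
    proof
      fix e assume e: "e \<in> E - ?A"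
      then have "card e = 2" using E by (auto simp: simple_graph_def)
      then obtain a b where ab: "e = {a, b}" by (auto simp: card_2_iff)
      have *: "a \<noteq> p \<and> a \<noteq> q" if "{a, b} \<in> E - ?A" for a b
      proof -
        have "a = p \<Longrightarrow> b \<in> nbrs E p" "a = q \<Longrightarrow> b \<in> nbrs E q"
          using that by (auto simp: nbrs_def)
        then show ?thesis using that p q by (auto simp: insert_commute)
      qed
      have "a \<noteq> p \<and> a \<noteq> q" "b \<noteq> p \<and> b \<noteq> q"
        using *[of a b] *[of b a] e unfolding ab by (auto simp only: insert_commute[of b a])
      moreover have "{a, b} \<in> E" "{a, b} \<in> ?E" using e ab sub by auto
      moreover have "a \<in> \<Union>E" "b \<in> \<Union>E" using e ab by auto
      ultimately show "?h e = 0" unfolding ab by (simp add: ev ev0 same del: Union_iff)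
    qed
  qed
  also have "\<dots> = ?h {p, q} + (\<Sum>e\<in>(\<lambda>x. {p, x}) ` X. ?h e) + (\<Sum>e\<in>(\<lambda>y. {q, y}) ` Y. ?h e)"
  proof -
    have "{p, q} \<notin> (\<lambda>x. {p, x}) ` X \<union> (\<lambda>y. {q, y}) ` Y"
      using p q by (auto simp: doubleton_eq_iff)
    moreover have "(\<lambda>x. {p, x}) ` X \<inter> (\<lambda>y. {q, y}) ` Y = {}"
      using p q ear_distinct by (auto simp: doubleton_eq_iff)
    ultimately show ?thesis using p q by (simp add: sum.union_disjoint)
  qed
  also have "?h {p, q} = f (card X + 2) (card Y + 2) - f (card X + 1) (card Y + 1)"
    using pq sub by (simp add: ev ev0 dp dq subset_iff)
  also have "(\<Sum>e\<in>(\<lambda>x. {p, x}) ` X. ?h e)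
      = (\<Sum>x\<in>X. f (card X + 2) (degree E x) - f (card X + 1) (degree E x))"
  proof -
    have "inj_on (\<lambda>x. {p, x}) X" by (auto simp: inj_on_def doubleton_eq_iff)
    moreover have "?h {p, x} = f (card X + 2) (degree E x) - f (card X + 1) (degree E x)"
      if "x \<in> X" for x
      using X[OF that] sub same[of x] by (simp add: ev ev0 dp subset_iff del: Union_iff)
    ultimately show ?thesis by (simp add: sum.reindex)
  qed
  also have "(\<Sum>e\<in>(\<lambda>y. {q, y}) ` Y. ?h e)
      = (\<Sum>y\<in>Y. f (card Y + 2) (degree E y) - f (card Y + 1) (degree E y))"
  proof -
    have "inj_on (\<lambda>x. {q, x}) Y" by (auto simp: inj_on_def doubleton_eq_iff)
    moreover have "?h {q, x} = f (card Y + 2) (degree E x) - f (card Y + 1) (degree E x)"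
      if "x \<in> Y" for x
      using Y[OF that] sub same[of x] by (simp add: ev ev0 dq subset_iff del: Union_iff)
    ultimately show ?thesis by (simp add: sum.reindex)
  qed
  finally show ?thesis by simp
qed

end

section \<open>Two-connectedness of graphs built from ears\<close>

lemma graph_connected_insert:
  assumes G: "graph_connected V E" and sub: "E \<subseteq> E'" and y: "y \<in> V" and xy: "{x, y} \<in> E'"
  shows "graph_connected (insert x V) E'"
proof -
  let ?R = "{(x, y). {x, y} \<in> E}" and ?R' = "{(x, y). {x, y} \<in> E'}"
  have "?R\<^sup>* \<subseteq> ?R'\<^sup>*" using sub by (intro rtrancl_mono) auto
  then have old: "(a, b) \<in> ?R'\<^sup>*" if "a \<in> V" "b \<in> V" for a b
    using G that by (auto simp: graph_connected_def)
  have "(x, y) \<in> ?R'\<^sup>*" "(y, x) \<in> ?R'\<^sup>*" using xy by (auto simp: insert_commute)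
  then have "(a, y) \<in> ?R'\<^sup>* \<and> (y, a) \<in> ?R'\<^sup>*" if "a \<in> insert x V" for a
    using old y that by auto
  then show ?thesis unfolding graph_connected_def by (meson rtrancl_trans)
qed

lemma graph_connected_singleton: "graph_connected {x} E"
  by (simp add: graph_connected_def)

text \<open>Deleting an inner vertex of the ear leaves the other one hanging on its end. Deleting an
  old vertex leaves the old graph connected, and both inner vertices reach it through an end that
  survives.\<close>

lemma two_connected_ear:
  assumes tc: "two_connected (\<Union>E) E" and E: "simple_graph E" and pq: "{p, q} \<in> E"
    and fresh: "u \<notin> \<Union>E" "w \<notin> \<Union>E" "u \<noteq> w"
  shows "two_connected (\<Union>(ear E p q u w)) (ear E p q u w)"
proof -
  let ?E = "ear E p q u w"
  note dist = ear_distinct[OF E pq fresh]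
  have V: "\<Union>?E = insert u (insert w (\<Union>E))" using pq by (auto simp: ear_def)
  have fin: "finite (\<Union>E)"
  proof -
    have "finite e" if "e \<in> E" for e
      using E that by (intro card_ge_0_finite) (simp add: simple_graph_def)
    then show ?thesis using E by (auto simp: simple_graph_def)
  qed
  have "card (\<Union>E) \<le> card (\<Union>?E)" unfolding V by (intro card_mono) (use fin in auto)
  then have "3 \<le> card (\<Union>?E)" using tc by (simp add: two_connected_def)
  moreover have pV: "p \<in> \<Union>E" "q \<in> \<Union>E" using pq by auto
  have con: "graph_connected (\<Union>E) E" using tc by (simp add: two_connected_def)
  have del: "graph_connected (\<Union>E - {v}) {e \<in> E. v \<notin> e}" if "v \<in> \<Union>E" for v
    using tc that unfolding two_connected_def by blast
  have "graph_connected (\<Union>?E) ?E"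
    unfolding V
    by (rule graph_connected_insert[OF graph_connected_insert[OF con _ pV(2), of ?E w], of ?E w u])
       (simp_all add: ear_def insert_commute subset_iff)
  moreover have "graph_connected (\<Union>?E - {v}) {e \<in> ?E. v \<notin> e}" if v: "v \<in> \<Union>?E" for v
  proof -
    let ?D = "{e \<in> ?E. v \<notin> e}"
    \<comment> \<open>The case \<open>v = q\<close> belongs to the third alternative, where the ear
      hangs on \<open>p\<close>; it hangs on \<open>q\<close> only when \<open>p\<close> itself is
      deleted.\<close>
    consider "v = u" | "v = w" | "v \<in> \<Union>E" "v \<noteq> p" | "v = p" using v V by auto
    then show ?thesis
    proof cases
      case 1
      have "E \<subseteq> ?D" using 1 fresh by (auto simp: ear_def)
      then have "graph_connected (insert w (\<Union>E)) ?D"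
        by (rule graph_connected_insert[OF con _ pV(2)]) (use 1 dist fresh in \<open>auto simp: ear_def\<close>)
      moreover have "\<Union>?E - {v} = insert w (\<Union>E)" unfolding V using 1 fresh by auto
      ultimately show ?thesis by simp
    next
      case 2
      have "E \<subseteq> ?D" using 2 fresh by (auto simp: ear_def)
      then have "graph_connected (insert u (\<Union>E)) ?D"
        by (rule graph_connected_insert[OF con _ pV(1)])
           (use 2 dist fresh in \<open>auto simp: ear_def insert_commute\<close>)
      moreover have "\<Union>?E - {v} = insert u (\<Union>E)" unfolding V using 2 fresh by auto
      ultimately show ?thesis by simp
    next
      case 3
      have vuw: "v \<noteq> u" "v \<noteq> w" using 3 fresh by auto
      have "{e \<in> E. v \<notin> e} \<subseteq> ?D" by (auto simp: ear_def)
      then have "graph_connected (insert u (\<Union>E - {v})) ?D"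
        by (rule graph_connected_insert[OF del[OF 3(1)] _, of _ p])
           (use 3 pV vuw in \<open>auto simp: ear_def insert_commute\<close>)
      then have "graph_connected (insert w (insert u (\<Union>E - {v}))) ?D"
        by (rule graph_connected_insert[of _ ?D _ u])
           (use vuw in \<open>auto simp: ear_def insert_commute\<close>)
      moreover have "\<Union>?E - {v} = insert w (insert u (\<Union>E - {v}))"
        unfolding V using vuw by auto
      ultimately show ?thesis by simp
    next
      case 4
      have v': "v \<in> \<Union>E" using 4 pV by simp
      have "{e \<in> E. v \<notin> e} \<subseteq> ?D" by (auto simp: ear_def)
      then have "graph_connected (insert w (\<Union>E - {v})) ?D"
        by (rule graph_connected_insert[OF del[OF v'] _, of _ q])
           (use 4 pV dist in \<open>auto simp: ear_def insert_commute\<close>)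
      then have "graph_connected (insert u (insert w (\<Union>E - {v}))) ?D"
        by (rule graph_connected_insert[of _ ?D _ w])
           (use 4 dist in \<open>auto simp: ear_def insert_commute\<close>)
      moreover have "\<Union>?E - {v} = insert u (insert w (\<Union>E - {v}))"
        unfolding V using 4 dist by auto
      ultimately show ?thesis by simp
    qed
  qed
  ultimately show ?thesis by (simp add: two_connected_def)
qed

lemma two_connected_quadrilateral:
  assumes "distinct [a, b, c, d]"
  shows "two_connected {a, b, c, d} {{a, b}, {b, c}, {c, d}, {d, a}}"
proof -
  let ?E = "{{a, b}, {b, c}, {c, d}, {d, a}}"
  have mono: "graph_connected {x, y, z} D" if "{x, y} \<in> D" "{y, z} \<in> D" for x y z :: 'a and D
    by (rule graph_connected_insert[OF graph_connected_insert[OF graph_connected_singleton[of z D],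
          of D z y], of D y x]) (use that in auto)
  have "graph_connected {a, b, c, d} ?E"
    by (rule graph_connected_insert[OF mono[of b c ?E d], of ?E b a]) simp_all
  moreover have "graph_connected ({a, b, c, d} - {v}) {e \<in> ?E. v \<notin> e}" if v: "v \<in> {a, b, c, d}" for v
  proof -
    consider "v = a" | "v = b" | "v = c" | "v = d" using v by auto
    then show ?thesis
    proof cases
      case 1
      then have *: "{a, b, c, d} - {v} = {b, c, d}" using assms by auto
      show ?thesis unfolding * by (rule mono) (use 1 assms in auto)
    next
      case 2
      then have *: "{a, b, c, d} - {v} = {c, d, a}" using assms by auto
      show ?thesis unfolding * by (rule mono) (use 2 assms in auto)
    next
      case 3
      then have *: "{a, b, c, d} - {v} = {d, a, b}" using assms by auto
      show ?thesis unfolding * by (rule mono) (use 3 assms in auto)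
    next
      case 4
      then have *: "{a, b, c, d} - {v} = {a, b, c}" using assms by auto
      show ?thesis unfolding * by (rule mono) (use 4 assms in auto)
    qed
  qed
  ultimately show ?thesis using assms by (simp add: two_connected_def)
qed

section \<open>Drifting walks of cells\<close>

fun opp :: "orientation \<Rightarrow> orientation" where
  "opp Rightwards = Leftwards"
| "opp Leftwards = Rightwards"
| "opp Upwards = Downwards"
| "opp Downwards = Upwards"

definition perp :: "orientation \<Rightarrow> orientation \<Rightarrow> bool" where
  "perp d e \<longleftrightarrow> direction_of d \<noteq> direction_of e"

lemma opp_opp [simp]: "opp (opp d) = d"
  by (cases d) auto

lemma opp_neq [simp]: "opp d \<noteq> d" "d \<noteq> opp d"
  by (cases d; simp)+

lemma direction_of_opp [simp]: "direction_of (opp d) = direction_of d"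
  by (cases d) auto

lemma direction_of_eq_iff: "direction_of d = direction_of e \<longleftrightarrow> d = e \<or> d = opp e"
  by (cases d; cases e) auto

lemma perp_opp [simp]: "perp (opp d) e = perp d e" "perp d (opp e) = perp d e"
  by (auto simp: perp_def)

lemma perp_sym: "perp d e \<Longrightarrow> perp e d"
  by (auto simp: perp_def)

lemma perp_irrefl [simp]: "\<not> perp d d"
  by (simp add: perp_def)

lemma perp_cases: "perp d e \<Longrightarrow> perp d e' \<Longrightarrow> e' = e \<or> e' = opp e"
  by (cases d; cases e; cases e') (auto simp: perp_def)

lemma ex_perp: "\<exists>e. perp d e"
  by (cases d) (auto simp: perp_def intro: exI[of _ Upwards] exI[of _ Rightwards])

text \<open>\<open>corner c d e\<close> is the vertex of the cell \<open>c\<close> extreme in the perpendicular orientations \<open>d\<close>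
  and \<open>e\<close>.\<close>

definition corner :: "cell \<Rightarrow> orientation \<Rightarrow> orientation \<Rightarrow> point" where
  "corner c d e = (fst c + (if d = Rightwards \<or> e = Rightwards then 1 else 0),
                   snd c + (if d = Upwards \<or> e = Upwards then 1 else 0))"

lemma corner_commute: "corner c d e = corner c e d"
  by (auto simp: corner_def)

lemma attach_opp [simp]: "attach (opp d) (attach d c) = c" "attach d (attach (opp d) c) = c"
  by (cases c; cases d; simp)+

lemma attach_inject: "attach d c = attach e c \<longleftrightarrow> d = e"
  by (cases c; cases d; cases e) auto

lemma corner_attach [simp]: "perp d e \<Longrightarrow> corner (attach d c) (opp d) e = corner c d e"
  by (cases c; cases d; cases e) (auto simp: corner_def perp_def)

lemma corner_distinct:
  assumes "perp d e"
  shows "distinct [corner c d e, corner c d (opp e), corner c (opp d) e, corner c (opp d) (opp e)]"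
  using assms by (cases c; cases d; cases e) (auto simp: corner_def perp_def)

lemma sides_corner:
  assumes "perp d e"
  shows "sides c = {{corner c d e, corner c d (opp e)}, {corner c (opp d) e, corner c (opp d) (opp e)},
    {corner c d e, corner c (opp d) e}, {corner c d (opp e), corner c (opp d) (opp e)}}"
  using assms by (cases c; cases d; cases e) (auto simp: corner_def perp_def insert_commute)

text \<open>The bridge from squares to graphs: the ends of the ear are the vertices of the common
  side. That its inner vertices are new is a separate matter, settled by
  \<open>drifting_fresh_corner\<close>.\<close>

lemma sides_attach_ear:
  assumes "perp d e" "sides c \<subseteq> E"
  shows "E \<union> sides (attach d c) = ear E (corner c d e) (corner c d (opp e))
    (corner (attach d c) d e) (corner (attach d c) d (opp e))"
proof -
  have "{corner c d e, corner c d (opp e)} \<in> E"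
    using assms sides_corner[OF assms(1), of c] by auto
  then show ?thesis
    unfolding ear_def sides_corner[OF assms(1), of "attach d c"] using assms
    by (auto simp: insert_commute)
qed

lemma card_sides: "s \<in> sides c \<Longrightarrow> card s = 2"
  by (cases c) auto

lemma Union_sides: "\<Union>(sides (x, y)) = {x, x + 1} \<times> {y, y + 1}"
  by auto

lemma sides_inter:
  "sides (x, y) \<inter> sides (x', y') \<noteq> {} \<longleftrightarrow> \<bar>x - x'\<bar> + \<bar>y - y'\<bar> \<le> 1"
proof -
  have "sides (x, y) \<inter> sides (x', y') \<noteq> {} \<longleftrightarrow> (x = x' \<and> y = y') \<or> (x = x' \<and> y = y' + 1)
     \<or> (x = x' \<and> y' = y + 1) \<or> (x = x' + 1 \<and> y' = y) \<or> (x' = x + 1 \<and> y' = y)"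
    by (auto simp: doubleton_eq_iff)
  also have "\<dots> \<longleftrightarrow> \<bar>x - x'\<bar> + \<bar>y - y'\<bar> \<le> 1" by arith
  finally show ?thesis .
qed

lemma sides_inter_attach:
  "c \<noteq> c' \<Longrightarrow> sides c \<inter> sides c' \<noteq> {} \<Longrightarrow> \<exists>d. c' = attach d c"
proof -
  obtain x y x' y' where c: "c = (x, y)" "c' = (x', y')" by (cases c; cases c')
  assume "c \<noteq> c'" "sides c \<inter> sides c' \<noteq> {}"
  then have "(x', y') \<in> {(x + 1, y), (x - 1, y), (x, y + 1), (x, y - 1)}"
    unfolding c sides_inter by (auto simp: abs_if split: if_splits)
  then have "(x', y') \<in> (\<lambda>d. attach d (x, y)) ` {Rightwards, Leftwards, Upwards, Downwards}"
    by simp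
  then show ?thesis unfolding c by blast
qed

fun walk :: "cell \<Rightarrow> orientation list \<Rightarrow> cell list" where
  "walk c [] = [c]"
| "walk c (d # os) = attach d (hd (walk c os)) # walk c os"

text \<open>Orientation lists are read backwards, the latest square first. A walk drifts in the vertical
  orientation \<open>v\<close> and makes a horizontal U-turn only after two steps in the orientation \<open>v\<close>.\<close>

fun drifting :: "orientation \<Rightarrow> orientation list \<Rightarrow> bool" where
  "drifting v [] = False"
| "drifting v [d] = (d = Rightwards)"
| "drifting v (d # d' # os) = (drifting v (d' # os) \<and>
     (d = v \<or> direction_of d = Horizontal \<and> (d = d' \<or> d' = v \<and> hd os \<in> {v, d})))"

definition vertical :: "orientation \<Rightarrow> bool" where
  "vertical v \<longleftrightarrow> direction_of v = Vertical"

definition height :: "orientation \<Rightarrow> cell \<Rightarrow> int" where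
  "height v c = (if v = Upwards then snd c else - snd c)"

definition reach :: "orientation \<Rightarrow> cell \<Rightarrow> int" where
  "reach d c = (if d = Rightwards then fst c else - fst c)"

text \<open>The horizontal clause of \<open>drifting\<close>, made a predicate because
  \<open>bounded_walk\<close> must speak about every orientation in which the walk could continue.
  The guard \<open>os \<noteq> []\<close> keeps \<open>hd\<close> off the empty list;
  \<open>drifting_step\<close> shows that a drifting walk meets it.\<close>

fun advanceable :: "orientation \<Rightarrow> orientation \<Rightarrow> orientation list \<Rightarrow> bool" where
  "advanceable v d [] = True"
| "advanceable v d (d' # os) = (d' = d \<or> d' = v \<and> os \<noteq> [] \<and> hd os \<in> {v, d})"

lemma walk_nonempty [simp]: "walk c os \<noteq> []"
  by (cases os) auto

lemma length_walk [simp]: "length (walk c os) = length os + 1"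
  by (induction os) auto

lemma last_walk [simp]: "last (walk c os) = c"
  by (induction os) auto

lemma hd_walk_in [simp]: "hd (walk c os) \<in> set (walk c os)"
  by (rule hd_in_set) simp

text \<open>A further horizontal square stays in the row of the last one, so its vertices can meet
  earlier squares only there and in the row below, as nothing lies higher. Being alone in the top
  row after a vertical step makes the bound survive another vertical step, which turns the top row
  into the row below.\<close>

definition bounded_walk :: "orientation \<Rightarrow> orientation list \<Rightarrow> cell \<Rightarrow> bool" where
  "bounded_walk v os c \<longleftrightarrow> (let z = hd (walk c os) in
     \<forall>z'\<in>set (walk c os). height v z' \<le> height v z \<and>
       (hd os = v \<longrightarrow> height v z' = height v z \<longrightarrow> z' = z) \<and>
       (\<forall>d. direction_of d = Horizontal \<longrightarrow> advanceable v d os \<longrightarrow>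
          height v z - 1 \<le> height v z' \<longrightarrow> reach d z' \<le> reach d z))"

lemma drifting_nonempty: "drifting v os \<Longrightarrow> os \<noteq> []"
  by auto

lemma drifting_tl: "drifting v (d # os) \<Longrightarrow> os \<noteq> [] \<Longrightarrow> drifting v os"
  by (cases os) auto

lemma drifting_orientations:
  "drifting v os \<Longrightarrow> d \<in> set os \<Longrightarrow> d = v \<or> direction_of d = Horizontal"
  by (induction v os rule: drifting.induct) auto

lemma last_drifting: "drifting v os \<Longrightarrow> last os = Rightwards"
  by (induction v os rule: drifting.induct) auto

lemma drifting_step:
  assumes "vertical v" "drifting v (d # os)" "os \<noteq> []"
  shows "d = v \<or> direction_of d = Horizontal \<and> advanceable v d os"
proof -
  obtain d' os' where os: "os = d' # os'" using assms(3) by (cases os) auto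
  have "os' \<noteq> []" if "d' = v"
    using that assms unfolding os by (cases os') (auto simp: vertical_def)
  then show ?thesis using assms unfolding os by auto
qed

lemma height_attach:
  "vertical v \<Longrightarrow> height v (attach v z) = height v z + 1"
  "direction_of d = Horizontal \<Longrightarrow> height v (attach d z) = height v z"
  by (cases z; cases v; simp add: vertical_def height_def)
     (cases z; cases d; simp add: height_def)

lemma reach_attach:
  "direction_of d = Horizontal \<Longrightarrow> reach d (attach d z) = reach d z + 1"
  "vertical v \<Longrightarrow> reach d (attach v z) = reach d z"
  by (cases z; cases d; simp add: reach_def)
     (cases z; cases v; simp add: reach_def vertical_def)

text \<open>After a step \<open>v\<close> the row below is the old top row. It holds only the
  previous square if that one came by \<open>v\<close>, and the old invariant bounds it if that one
  came by the orientation \<open>e\<close> in question. After a horizontal step \<open>d\<close>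
  only \<open>d\<close> itself can be continued horizontally, and its reach has grown by
  one.\<close>

lemma bounded_walk:
  assumes "vertical v" "drifting v os"
  shows "bounded_walk v os c"
  using assms
proof (induction v os rule: drifting.induct)
  case (2 v d)
  then show ?case by (cases c) (auto simp: bounded_walk_def height_def reach_def vertical_def)
next
  case (3 v d d' os)
  let ?os = "d' # os"
  let ?z = "hd (walk c ?os)"
  let ?y = "attach d ?z"
  have IH: "bounded_walk v ?os c" using 3 by simp
  have old: "height v z' \<le> height v ?z"
    "d' = v \<Longrightarrow> height v z' = height v ?z \<Longrightarrow> z' = ?z"
    "direction_of e = Horizontal \<Longrightarrow> advanceable v e ?os \<Longrightarrow> height v ?z - 1 \<le> height v z'
      \<Longrightarrow> reach e z' \<le> reach e ?z" if "z' \<in> set (walk c ?os)" for z' e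
    using IH that unfolding bounded_walk_def Let_def by auto
  have vv: "vertical v" and dr: "drifting v (d # ?os)" using 3 by auto
  have step: "d = v \<or> direction_of d = Horizontal \<and> advanceable v d ?os"
    using drifting_step[OF vv dr] by simp
  have hd_tl: "hd (walk c (d # ?os)) = ?y" "set (walk c (d # ?os)) = insert ?y (set (walk c ?os))"
    by simp_all
  show ?case
  proof (cases "d = v")
    case True
    have h: "height v ?y = height v ?z + 1" "reach e ?y = reach e ?z" for e
      using height_attach(1)[OF vv] reach_attach(2)[OF vv] True by auto
    have "reach e z' \<le> reach e ?z" if z': "z' \<in> set (walk c ?os)" and e: "direction_of e = Horizontal"
      and adv: "advanceable v e (d # ?os)" and hz: "height v ?z \<le> height v z'" for e z'
    proof (cases "d' = v")
      case True
      then show ?thesis using old(1,2)[OF z'] hz by simp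
    next
      case False
      then have "d' = e" using adv e vv True by (auto simp: vertical_def)
      then show ?thesis using old(3)[OF z' e] hz by simp
    qed
    then show ?thesis using old(1) unfolding bounded_walk_def hd_tl Let_def h
      by (auto simp: h simp del: walk.simps advanceable.simps; fastforce)
  next
    case False
    then have d: "direction_of d = Horizontal" and adv: "advanceable v d ?os" using step by auto
    have h: "height v ?y = height v ?z" "reach d ?y = reach d ?z + 1"
      using height_attach(2)[OF d] reach_attach(1)[OF d] by auto
    have "reach e z' \<le> reach e ?y" if z': "z' \<in> set (walk c ?os)"
      and adv': "advanceable v e (d # ?os)" and hz: "height v ?z - 1 \<le> height v z'" for e z'
    proof -
      have "e = d" using adv' False by auto
      then show ?thesis using old(3)[OF z' d adv hz] h by simp
    qed
    then show ?thesis using old(1) False unfolding bounded_walk_def hd_tl Let_def h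
      by (auto simp: h simp del: walk.simps advanceable.simps)
  qed
qed simp

section \<open>Freshness and adjacency of the next square\<close>

text \<open>For a vertical step the far vertices lie above all earlier squares. For a horizontal
  step a square containing a far vertex would lie at most one row below the last square and reach
  further than it, against \<open>bounded_walk\<close>.\<close>

lemma drifting_fresh_corner:
  assumes v: "vertical v" and dr: "drifting v (d # os)" "os \<noteq> []" and e: "perp d e"
    and z': "z' \<in> set (walk c os)"
  shows "corner (attach d (hd (walk c os))) d e \<notin> \<Union>(sides z')"
proof -
  define z where "z = hd (walk c os)"
  obtain x y x' y' where zz: "z = (x, y)" "z' = (x', y')" by (cases z; cases z')
  have "bounded_walk v os c" using bounded_walk[OF v drifting_tl[OF dr]] .
  then have b: "height v z' \<le> height v z"
    "\<And>e. direction_of e = Horizontal \<Longrightarrow> advanceable v e os \<Longrightarrow> height v z - 1 \<le> height v z'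
      \<Longrightarrow> reach e z' \<le> reach e z"
    using z' unfolding bounded_walk_def Let_def z_def by auto
  show ?thesis
  proof (cases "d = v")
    case True
    then show ?thesis using v e b(1) unfolding z_def[symmetric] zz Union_sides
      by (cases v; cases e) (auto simp: vertical_def perp_def height_def corner_def)
  next
    case False
    then have d: "direction_of d = Horizontal" "advanceable v d os"
      using drifting_step[OF v dr] by auto
    show ?thesis using v e b(2)[OF d] d(1) unfolding z_def[symmetric] zz Union_sides
      by (cases v; cases d; cases e) (auto simp: vertical_def perp_def height_def reach_def corner_def)
  qed
qed

lemma drifting_fresh_cell:
  assumes v: "vertical v" and dr: "drifting v (d # os)" "os \<noteq> []"
  shows "attach d (hd (walk c os)) \<notin> set (walk c os)"
proof
  let ?c = "attach d (hd (walk c os))"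
  assume "?c \<in> set (walk c os)"
  moreover obtain e where "perp d e" using ex_perp by blast
  moreover from this have "corner ?c d e \<in> \<Union>(sides ?c)" unfolding sides_corner[OF \<open>perp d e\<close>] by auto
  ultimately show False using drifting_fresh_corner[OF v dr] by blast
qed

text \<open>Of the four neighbours of the new cell, three are too high (vertical step) or reach too
  far (horizontal step) to be earlier squares; the fourth is the last square.\<close>

lemma drifting_adjacent:
  assumes v: "vertical v" and dr: "drifting v (d # os)" "os \<noteq> []" and z': "z' \<in> set (walk c os)"
  shows "sides (attach d (hd (walk c os))) \<inter> sides z' \<noteq> {} \<longleftrightarrow> z' = hd (walk c os)"
proof -
  define z where "z = hd (walk c os)"
  obtain x y x' y' where zz: "z = (x, y)" "z' = (x', y')" by (cases z; cases z')
  have neq: "attach d z \<noteq> z'" using drifting_fresh_cell[OF v dr, of c] z' unfolding z_def by auto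
  have "bounded_walk v os c" using bounded_walk[OF v drifting_tl[OF dr]] .
  then have b: "height v z' \<le> height v z"
    "\<And>e. direction_of e = Horizontal \<Longrightarrow> advanceable v e os \<Longrightarrow> height v z - 1 \<le> height v z'
      \<Longrightarrow> reach e z' \<le> reach e z"
    using z' unfolding bounded_walk_def Let_def z_def by auto
  show ?thesis
  proof (cases "d = v")
    case True
    show ?thesis
      using v b(1) neq unfolding z_def[symmetric] zz True
      by (cases v; simp only: attach.simps sides_inter vertical_def height_def)
        (auto simp: abs_if split: if_splits)
  next
    case False
    then have d: "direction_of d = Horizontal" "advanceable v d os"
      using drifting_step[OF v dr] by auto
    show ?thesis
      using v b(2)[OF d] d(1) neq unfolding z_def[symmetric] zz
      by (cases v; cases d; simp only: attach.simps sides_inter vertical_def height_def reach_def)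
        (auto simp: abs_if split: if_splits)
  qed
qed

section \<open>The index of a drifting walk\<close>

text \<open>The free end of a chain: the last square \<open>c\<close> has been attached in the orientation \<open>d = hd os\<close>. On
  its side \<open>e\<close>, the vertex shared with the previous square either has degree 4 (encoded by
  \<open>arm os e = 0\<close>) or has exactly one neighbour outside \<open>c\<close>, and \<open>arm os e\<close> is the degree of that
  neighbour.\<close>

fun arm :: "orientation list \<Rightarrow> orientation \<Rightarrow> nat" where
  "arm [] e = 0"
| "arm [d] e = 2"
| "arm (d # d' # os) e =
     (if d = d' then if arm (d' # os) e = 0 then 4 else 3 else if e = d' then 2 else 0)"

definition base_degree :: "orientation list \<Rightarrow> orientation \<Rightarrow> nat" where
  "base_degree os e = (if arm os e = 0 then 4 else 3)"

text \<open>The local data that \<open>TI_ear\<close> asks for at the next square, on either side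
  \<open>e\<close>. The neighbour outside \<open>c\<close> is named as a rear vertex of the previous
  cell \<open>attach (opp d) c\<close>.\<close>

definition free_end :: "point set set \<Rightarrow> orientation list \<Rightarrow> cell \<Rightarrow> bool" where
  "free_end E os c \<longleftrightarrow> (let d = hd os in \<forall>e. perp d e \<longrightarrow>
     nbrs E (corner c d e) = {corner c (opp d) e, corner c d (opp e)} \<and>
     (if arm os e = 0 then degree E (corner c (opp d) e) = 4
      else nbrs E (corner c (opp d) e) =
             {corner (attach (opp d) c) (opp d) e, corner c (opp d) (opp e), corner c d e} \<and>
           degree E (corner (attach (opp d) c) (opp d) e) = arm os e))"

lemma free_endD:
  assumes "free_end E os c" "d = hd os" "perp d e"
  shows "nbrs E (corner c d e) = {corner c (opp d) e, corner c d (opp e)}"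
    and "arm os e = 0 \<Longrightarrow> degree E (corner c (opp d) e) = 4"
    and "arm os e \<noteq> 0 \<Longrightarrow> nbrs E (corner c (opp d) e) =
             {corner (attach (opp d) c) (opp d) e, corner c (opp d) (opp e), corner c d e}"
    and "arm os e \<noteq> 0 \<Longrightarrow> degree E (corner (attach (opp d) c) (opp d) e) = arm os e"
  using assms unfolding free_end_def Let_def by presburger+

lemma corner_back_distinct:
  assumes "perp d e"
  shows "corner (attach (opp d) c) (opp d) e \<notin>
    {corner c d e, corner c d (opp e), corner c (opp d) e, corner c (opp d) (opp e)}"
  using assms by (cases c; cases d; cases e) (auto simp: corner_def perp_def)

lemma corner_neq:
  assumes "perp d e"
  shows "corner c d e \<noteq> corner c d (opp e)"
    "corner c d e \<noteq> corner c (opp d) e"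
    "corner c d e \<noteq> corner c (opp d) (opp e)"
    "corner c d (opp e) \<noteq> corner c d e"
    "corner c d (opp e) \<noteq> corner c (opp d) e"
    "corner c d (opp e) \<noteq> corner c (opp d) (opp e)"
    "corner c (opp d) e \<noteq> corner c d e"
    "corner c (opp d) e \<noteq> corner c d (opp e)"
    "corner c (opp d) e \<noteq> corner c (opp d) (opp e)"
    "corner c (opp d) (opp e) \<noteq> corner c d e"
    "corner c (opp d) (opp e) \<noteq> corner c d (opp e)"
    "corner c (opp d) (opp e) \<noteq> corner c (opp d) e"
    "corner (attach (opp d) c) (opp d) e \<noteq> corner c d e"
    "corner (attach (opp d) c) (opp d) e \<noteq> corner c d (opp e)"
    "corner (attach (opp d) c) (opp d) e \<noteq> corner c (opp d) e"
    "corner (attach (opp d) c) (opp d) e \<noteq> corner c (opp d) (opp e)"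
    "corner c d e \<noteq> corner (attach (opp d) c) (opp d) e"
    "corner c d (opp e) \<noteq> corner (attach (opp d) c) (opp d) e"
    "corner c (opp d) e \<noteq> corner (attach (opp d) c) (opp d) e"
    "corner c (opp d) (opp e) \<noteq> corner (attach (opp d) c) (opp d) e"
  using corner_distinct[OF assms, of c] corner_back_distinct[OF assms, of c]
  by fastforce+

lemma corner_attach' [simp]:
  "perp d e \<Longrightarrow> corner (attach d c) e (opp d) = corner c d e"
  "perp d e \<Longrightarrow> corner (attach d c) (opp e) (opp d) = corner c d (opp e)"
  by (simp_all add: corner_commute[of _ _ "opp d"])

lemma corner_in_sides: "perp d e \<Longrightarrow> corner c d e \<in> \<Union>(sides c)"
  using sides_corner[of d e c] by auto

context
  fixes E :: "point set set" and os :: "orientation list" and c :: cell and d :: orientation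
  assumes E: "simple_graph E" and sub: "sides c \<subseteq> E" and fe: "free_end E os c" and d: "d = hd os"
begin

lemma degree_base: "perp d e \<Longrightarrow> degree E (corner c (opp d) e) = base_degree os e"
  unfolding base_degree_def
  using free_endD(2,3)[OF fe d, of e] corner_neq[of d e c]
  by (cases "arm os e = 0") (simp_all add: degree_nbrs[OF E])

lemma degree_tip: "perp d e \<Longrightarrow> degree E (corner c d e) = 2"
  using corner_neq[of d e c] by (simp add: free_endD(1)[OF fe d] degree_nbrs[OF E])

lemma corner_in_E: "perp e e' \<Longrightarrow> corner c e e' \<in> \<Union>E"
  using corner_in_sides[of e e' c] sub by blast

text \<open>The old far vertices become the vertices shared with the previous square, now of degree
  3. Their outside neighbours are the old shared vertices, which the ear does not touch, so the new
  \<open>arm\<close> is the old \<open>base_degree\<close>.\<close>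

lemma free_end_straight:
  assumes os: "os \<noteq> []" and fresh: "\<And>e. perp d e \<Longrightarrow> corner (attach d c) d e \<notin> \<Union>E"
  shows "free_end (E \<union> sides (attach d c)) (d # os) (attach d c)"
  unfolding free_end_def Let_def list.sel
proof (intro allI impI)
  fix e assume e: "perp d e"
  let ?c = "attach d c"
  let ?E = "E \<union> sides ?c"
  have e': "perp d (opp e)" using e by simp
  note D = corner_neq[OF e, of c] corner_neq[OF e, of ?c]
  note eq = sides_attach_ear[OF e sub]
  have pq: "{corner c d e, corner c d (opp e)} \<in> E" using sub sides_corner[OF e, of c] by auto
  have ne: "corner ?c d e \<noteq> corner ?c d (opp e)" using D by simp
  note ear = E pq fresh[OF e] fresh[OF e'] ne
  have arm: "arm (d # os) e = base_degree os e"
    using os d by (cases os) (auto simp: base_degree_def)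
  have "nbrs ?E (corner ?c d e) = {corner ?c (opp d) e, corner ?c d (opp e)}"
    unfolding eq using nbrs_ear_new_left[OF ear] e by simp
  moreover have "nbrs ?E (corner ?c (opp d) e) =
      {corner (attach (opp d) ?c) (opp d) e, corner ?c (opp d) (opp e), corner ?c d e}"
    unfolding eq using nbrs_ear_left[OF ear] free_endD(1)[OF fe d e] e by (simp add: insert_commute)
  moreover have "degree ?E (corner (attach (opp d) ?c) (opp d) e) = base_degree os e"
  proof -
    have "nbrs ?E (corner c (opp d) e) = nbrs E (corner c (opp d) e)"
      unfolding eq by (rule nbrs_ear_other[OF ear]) (use D e corner_in_E[of "opp d" e] in auto)
    then have "degree ?E (corner c (opp d) e) = degree E (corner c (opp d) e)"
      using simple_graph_ear[OF ear] unfolding eq by (simp add: degree_nbrs E)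
    then show ?thesis using degree_base[OF e] by simp
  qed
  ultimately show "nbrs ?E (corner ?c d e) = {corner ?c (opp d) e, corner ?c d (opp e)} \<and>
     (if arm (d # os) e = 0 then degree ?E (corner ?c (opp d) e) = 4
      else nbrs ?E (corner ?c (opp d) e) =
             {corner (attach (opp d) ?c) (opp d) e, corner ?c (opp d) (opp e), corner ?c d e} \<and>
           degree ?E (corner (attach (opp d) ?c) (opp d) e) = arm (d # os) e)"
    unfolding arm by (simp add: base_degree_def)
qed

text \<open>The edge between the old far vertices passes from \<open>f 2 2\<close> to
  \<open>f 3 3\<close>, and the new far edge contributes \<open>f 2 2\<close> again. The two
  brackets are the edges along the sides of the last square.\<close>

lemma TI_straight:
  assumes f: "sym_pos f" and e: "perp d e"
    and fresh: "\<And>e. perp d e \<Longrightarrow> corner (attach d c) d e \<notin> \<Union>E"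
  shows "TI f (E \<union> sides (attach d c)) = TI f E + f 3 3 + 2 * f 3 2
    + (f 3 (base_degree os e) - f 2 (base_degree os e))
    + (f 3 (base_degree os (opp e)) - f 2 (base_degree os (opp e)))"
proof -
  let ?c = "attach d c"
  have e': "perp d (opp e)" using e by simp
  note D = corner_neq[OF e, of c] corner_neq[OF e, of ?c]
  have pq: "{corner c d e, corner c d (opp e)} \<in> E" using sub sides_corner[OF e, of c] by auto
  have ne: "corner ?c d e \<noteq> corner ?c d (opp e)" using D by simp
  note ear = E pq fresh[OF e] fresh[OF e'] ne
  have "nbrs E (corner c d e) = insert (corner c d (opp e)) {corner c (opp d) e}"
    using free_endD(1)[OF fe d e] by (simp add: insert_commute)
  moreover have "nbrs E (corner c d (opp e)) = insert (corner c d e) {corner c (opp d) (opp e)}"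
    using free_endD(1)[OF fe d e'] by (simp add: insert_commute)
  ultimately show ?thesis
    unfolding sides_attach_ear[OF e sub]
    using TI_ear[OF ear f, of "{corner c (opp d) e}" "{corner c (opp d) (opp e)}"] D
      degree_base[OF e] degree_base[OF e']
    by (simp add: numeral_eq_Suc)
qed

context
  fixes e :: orientation
  assumes e: "perp d e" and arm: "arm os e \<noteq> 0"
    and fresh: "\<And>d'. perp e d' \<Longrightarrow> corner (attach e c) e d' \<notin> \<Union>E"
begin

lemma turn_ear:
  "E \<union> sides (attach e c) = ear E (corner c (opp d) e) (corner c d e)
     (corner (attach e c) e (opp d)) (corner (attach e c) e d)"
  "{corner c (opp d) e, corner c d e} \<in> E"
  "corner (attach e c) e (opp d) \<notin> \<Union>E" "corner (attach e c) e d \<notin> \<Union>E"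
  "corner (attach e c) e (opp d) \<noteq> corner (attach e c) e d"
proof -
  have ed: "perp e (opp d)" "perp e d" using e perp_sym by auto
  show "E \<union> sides (attach e c) = ear E (corner c (opp d) e) (corner c d e)
     (corner (attach e c) e (opp d)) (corner (attach e c) e d)"
    using sides_attach_ear[OF ed(1) sub] by (simp add: corner_commute[of c e])
  show "{corner c (opp d) e, corner c d e} \<in> E"
    using sub sides_corner[OF e, of c] by (auto simp: insert_commute)
  show "corner (attach e c) e (opp d) \<notin> \<Union>E" "corner (attach e c) e d \<notin> \<Union>E"
    using fresh ed by auto
  show "corner (attach e c) e (opp d) \<noteq> corner (attach e c) e d"
    using corner_distinct[OF ed(1), of "attach e c"] by simp
qed

text \<open>On side \<open>e\<close> the ear ends in a shared vertex, raised from degree 3 to 4, and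
  in a far vertex, raised from 2 to 3. The former gives \<open>arm\<close> 0 on the side
  \<open>opp d\<close>; on the side \<open>d\<close> the outside neighbour is the remaining old far
  vertex, still of degree 2.\<close>

lemma free_end_turn:
  assumes os: "os \<noteq> []"
  shows "free_end (E \<union> sides (attach e c)) (e # os) (attach e c)"
  unfolding free_end_def Let_def list.sel
proof (intro allI impI)
  let ?c = "attach e c"
  let ?E = "E \<union> sides ?c"
  fix d' assume "perp e d'"
  then have d': "d' = d \<or> d' = opp d" using perp_cases e perp_sym by blast
  have ed: "perp e (opp d)" "perp e d" using e perp_sym by auto
  have e': "perp d (opp e)" using e by simp
  note D = corner_neq[OF e, of c] corner_neq[OF ed(1), of ?c]
  note eq = turn_ear(1)
  note ear = E turn_ear(2-5)
  have tip: "nbrs E (corner c d e) = {corner c (opp d) e, corner c d (opp e)}"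
    by (rule free_endD(1)[OF fe d e])
  have arms: "arm (e # os) d = 2" "arm (e # os) (opp d) = 0"
    using os d e by (cases os; auto)+
  show "nbrs ?E (corner ?c e d') = {corner ?c (opp e) d', corner ?c e (opp d')} \<and>
     (if arm (e # os) d' = 0 then degree ?E (corner ?c (opp e) d') = 4
      else nbrs ?E (corner ?c (opp e) d') =
             {corner (attach (opp e) ?c) (opp e) d', corner ?c (opp e) (opp d'), corner ?c e d'} \<and>
           degree ?E (corner (attach (opp e) ?c) (opp e) d') = arm (e # os) d')"
    using d'
  proof
    assume d': "d' = d"
    have 1: "nbrs ?E (corner ?c e d) = {corner c e d, corner ?c e (opp d)}"
      unfolding eq using nbrs_ear_new_right[OF ear] by (simp add: corner_commute[of c e])
    have 2: "nbrs ?E (corner c e d) = {corner c (opp e) d, corner c e (opp d), corner ?c e d}"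
      unfolding eq corner_commute[of c e] corner_commute[of c "opp e"]
      using nbrs_ear_right[OF ear] tip by (simp add: insert_commute)
    have "nbrs ?E (corner c d (opp e)) = nbrs E (corner c d (opp e))"
      unfolding eq by (rule nbrs_ear_other[OF ear]) (use D e corner_in_E[OF e'] in auto)
    then have "degree ?E (corner c d (opp e)) = 2"
      using simple_graph_ear[OF ear] degree_tip[OF e'] unfolding eq by (simp add: degree_nbrs E)
    then show ?thesis using 1 2 ed arms unfolding d' by (simp add: corner_commute[of c "opp e"])
  next
    assume d': "d' = opp d"
    have 1: "nbrs ?E (corner ?c e (opp d)) = {corner c e (opp d), corner ?c e d}"
      unfolding eq using nbrs_ear_new_left[OF ear] by (simp add: corner_commute[of c e])
    have "nbrs ?E (corner c (opp d) e) = insert (corner ?c e (opp d)) (nbrs E (corner c (opp d) e))"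
      unfolding eq by (rule nbrs_ear_left[OF ear])
    moreover have "card (nbrs E (corner c (opp d) e)) = 3"
      using degree_base[OF e] arm by (simp add: degree_nbrs[OF E] base_degree_def)
    moreover have "corner ?c e (opp d) \<notin> nbrs E (corner c (opp d) e)"
      using nbrs_in_vertices[THEN conjunct1] turn_ear(3) by (rule contrapos_nn[rotated])
    ultimately have "card (nbrs ?E (corner c (opp d) e)) = 4"
      by (simp add: card_insert_disjoint card_ge_0_finite)
    then have "degree ?E (corner c (opp d) e) = 4"
      using simple_graph_ear[OF ear] unfolding eq by (simp add: degree_nbrs)
    then show ?thesis using 1 ed arms unfolding d' by (simp add: corner_commute[of c e])
  qed
qed

text \<open>The edge between the old far vertices changes by \<open>f 3 2 - f 2 2\<close> and the
  side along which the square is glued by \<open>f 4 3 - f 3 2\<close>; together with the new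
  \<open>f 2 2\<close> these leave only \<open>f 4 3\<close>.\<close>

lemma TI_turn:
  assumes f: "sym_pos f"
  shows "TI f (E \<union> sides (attach e c)) = TI f E + f 4 2 + f 3 2 + f 4 3
    + (f 4 (arm os e) - f 3 (arm os e))
    + (f 4 (base_degree os (opp e)) - f 3 (base_degree os (opp e)))"
proof -
  let ?c = "attach e c"
  let ?b = "corner (attach (opp d) c) (opp d) e"
  have e': "perp d (opp e)" using e by simp
  note D = corner_neq[OF e, of c]
  note ear = E turn_ear(2-5)
  have p: "nbrs E (corner c (opp d) e) = insert (corner c d e) {?b, corner c (opp d) (opp e)}"
    using free_endD(3)[OF fe d e arm] by (simp add: insert_commute)
  have q: "nbrs E (corner c d e) = insert (corner c (opp d) e) {corner c d (opp e)}"
    by (rule free_endD(1)[OF fe d e])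
  have b: "?b \<noteq> corner c (opp d) (opp e)" using D by auto
  have "corner c d e \<notin> {?b, corner c (opp d) (opp e)}" "corner c (opp d) e \<notin> {corner c d (opp e)}"
    using D by auto
  from TI_ear[OF ear f p this(1) _ q this(2)]
  show ?thesis
    unfolding turn_ear(1)
    using b degree_base[OF e'] degree_tip[OF e'] free_endD(4)[OF fe d e arm]
    by (simp add: numeral_eq_Suc)
qed

end

end

section \<open>The first two squares and the value of a walk\<close>

lemma simple_graph_sides: "simple_graph (sides c)"
  by (cases c) (auto simp: simple_graph_def)

lemma nbrs_sides:
  assumes "perp d e"
  shows "nbrs (sides c) (corner c d e) = {corner c (opp d) e, corner c d (opp e)}"
  unfolding nbrs_def sides_corner[OF assms] using corner_neq[OF assms, of c]
  by (auto simp: doubleton_eq_iff)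

lemma degree_sides: "perp d e \<Longrightarrow> degree (sides c) (corner c d e) = 2"
  using corner_neq[of d e c] by (simp add: degree_nbrs[OF simple_graph_sides] nbrs_sides)

lemma TI_sides:
  assumes f: "sym_pos f"
  shows "TI f (sides c) = 4 * f 2 2"
proof -
  have e: "perp Rightwards Upwards" by (simp add: perp_def)
  have deg: "degree (sides c) p = 2" if p: "p \<in> \<Union>(sides c)" for p
  proof -
    have "p \<in> {corner c Rightwards Upwards, corner c Rightwards Downwards,
        corner c Leftwards Upwards, corner c Leftwards Downwards}"
      using p unfolding sides_corner[OF e] by auto
    then show ?thesis
      using degree_sides[of Rightwards Upwards c] degree_sides[of Rightwards Downwards c]
        degree_sides[of Leftwards Upwards c] degree_sides[of Leftwards Downwards c]
      by (auto simp: perp_def)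
  qed
  have "edge_value f (sides c) s = f 2 2" if s: "s \<in> sides c" for s
  proof -
    obtain p q where pq: "s = {p, q}" using card_sides[OF s] by (auto simp: card_2_iff)
    then have "p \<in> \<Union>(sides c)" "q \<in> \<Union>(sides c)" using s by auto
    then show ?thesis using edge_value_eq[OF f simple_graph_sides] deg s unfolding pq by simp
  qed
  moreover have "card (sides c) = 4"
    by (cases c) (simp add: doubleton_eq_iff)
  ultimately show ?thesis by (simp add: TI_edge_value)
qed

lemma fresh_sides: "perp d e \<Longrightarrow> corner (attach d c) d e \<notin> \<Union>(sides c)"
  by (cases c; cases d; cases e) (auto simp: corner_def perp_def)

text \<open>The recursion on degrees starts with two squares, since a single square has no last
  orientation.\<close>

lemma free_end_domino: "free_end (sides c \<union> sides (attach d c)) [d] (attach d c)"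
  unfolding free_end_def Let_def list.sel
proof (intro allI impI)
  fix e assume e: "perp d e"
  let ?c = "attach d c"
  let ?E = "sides c \<union> sides ?c"
  have e': "perp d (opp e)" "perp (opp d) e" using e by auto
  note D = corner_neq[OF e, of c] corner_neq[OF e, of ?c]
  note eq = sides_attach_ear[OF e order_refl]
  have pq: "{corner c d e, corner c d (opp e)} \<in> sides c" using sides_corner[OF e, of c] by auto
  have ne: "corner ?c d e \<noteq> corner ?c d (opp e)" using D by simp
  note ear = simple_graph_sides pq fresh_sides[OF e] fresh_sides[OF e'(1)] ne
  have "nbrs ?E (corner ?c d e) = {corner ?c (opp d) e, corner ?c d (opp e)}"
    unfolding eq using nbrs_ear_new_left[OF ear] e by simp
  moreover have "nbrs ?E (corner ?c (opp d) e) =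
      {corner (attach (opp d) ?c) (opp d) e, corner ?c (opp d) (opp e), corner ?c d e}"
    unfolding eq using nbrs_ear_left[OF ear] nbrs_sides[OF e] e by (simp add: insert_commute)
  moreover have "degree ?E (corner (attach (opp d) ?c) (opp d) e) = 2"
  proof -
    have "nbrs ?E (corner c (opp d) e) = nbrs (sides c) (corner c (opp d) e)"
      unfolding eq by (rule nbrs_ear_other[OF ear]) (use D corner_in_sides[OF e'(2)] in auto)
    then have "degree ?E (corner c (opp d) e) = degree (sides c) (corner c (opp d) e)"
      using simple_graph_ear[OF ear] unfolding eq by (simp add: degree_nbrs simple_graph_sides)
    then show ?thesis using degree_sides[OF e'(2)] by simp
  qed
  ultimately show "nbrs ?E (corner ?c d e) = {corner ?c (opp d) e, corner ?c d (opp e)} \<and>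
     (if arm [d] e = 0 then degree ?E (corner ?c (opp d) e) = 4
      else nbrs ?E (corner ?c (opp d) e) =
             {corner (attach (opp d) ?c) (opp d) e, corner ?c (opp d) (opp e), corner ?c d e} \<and>
           degree ?E (corner (attach (opp d) ?c) (opp d) e) = arm [d] e)"
    by simp
qed

lemma TI_domino:
  assumes f: "sym_pos f"
  shows "TI f (sides c \<union> sides (attach d c)) = 2 * f 2 2 + 4 * f 3 2 + f 3 3"
proof -
  obtain e where e: "perp d e" using ex_perp by blast
  let ?c = "attach d c"
  have e': "perp d (opp e)" "perp (opp d) e" "perp (opp d) (opp e)" using e by auto
  note D = corner_neq[OF e, of c] corner_neq[OF e, of ?c]
  have pq: "{corner c d e, corner c d (opp e)} \<in> sides c" using sides_corner[OF e, of c] by auto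
  have ne: "corner ?c d e \<noteq> corner ?c d (opp e)" using D by simp
  note ear = simple_graph_sides pq fresh_sides[OF e] fresh_sides[OF e'(1)] ne
  have p: "nbrs (sides c) (corner c d e) = insert (corner c d (opp e)) {corner c (opp d) e}"
    using nbrs_sides[OF e] by (simp add: insert_commute)
  have q: "nbrs (sides c) (corner c d (opp e)) = insert (corner c d e) {corner c (opp d) (opp e)}"
    using nbrs_sides[OF e'(1)] by (simp add: insert_commute)
  show ?thesis
    unfolding sides_attach_ear[OF e order_refl]
    using TI_ear[OF ear f p _ _ q] D degree_sides[OF e'(2)] degree_sides[OF e'(3)]
    by (simp add: numeral_eq_Suc TI_sides[OF f])
qed

lemma two_connected_sides: "two_connected (\<Union>(sides c)) (sides c)"
proof -
  obtain x y where c: "c = (x, y)" by (cases c)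
  have "sides c = {{(x, y), (x + 1, y)}, {(x + 1, y), (x + 1, y + 1)},
      {(x + 1, y + 1), (x, y + 1)}, {(x, y + 1), (x, y)}}"
    unfolding c by (auto simp: insert_commute)
  moreover have "\<Union>\<dots> = {(x, y), (x + 1, y), (x + 1, y + 1), (x, y + 1)}" by auto
  ultimately show ?thesis
    using two_connected_quadrilateral[of "(x, y)" "(x + 1, y)" "(x + 1, y + 1)" "(x, y + 1)"] by simp
qed

text \<open>The increments of \<open>TI_straight\<close> and \<open>TI_turn\<close>, as functions of
  the orientations alone. The sum over both perpendicular orientations avoids choosing a
  side.\<close>

definition gain :: "(nat \<Rightarrow> nat \<Rightarrow> real) \<Rightarrow> orientation list \<Rightarrow> orientation \<Rightarrow> real" where
  "gain f os d = (if d = hd os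
     then f 3 3 + 2 * f 3 2 + (\<Sum>e | perp d e. f 3 (base_degree os e) - f 2 (base_degree os e))
     else f 4 2 + f 3 2 + f 4 3 + (f 4 (arm os d) - f 3 (arm os d))
       + (f 4 (base_degree os (opp d)) - f 3 (base_degree os (opp d))))"

fun walk_value :: "(nat \<Rightarrow> nat \<Rightarrow> real) \<Rightarrow> orientation list \<Rightarrow> real" where
  "walk_value f [] = 4 * f 2 2"
| "walk_value f [d] = 2 * f 2 2 + 4 * f 3 2 + f 3 3"
| "walk_value f (d # os) = walk_value f os + gain f os d"

lemma perp_set: "perp d e \<Longrightarrow> {e. perp d e} = {e, opp e}"
  using perp_cases by auto

lemma chain_edges_walk:
  "chain_edges (walk c (d # os)) = chain_edges (walk c os) \<union> sides (attach d (hd (walk c os)))"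
  by (auto simp: chain_edges_def)

text \<open>A turn to a side with \<open>arm os d = 0\<close> would close a two by two block around
  a vertex of degree 4. Drifting walks avoid this, as they reverse a horizontal orientation only
  after two steps \<open>v\<close>.\<close>

lemma drifting_turn:
  assumes v: "vertical v" and dr: "drifting v (d # os)" "os \<noteq> []" and t: "d \<noteq> hd os"
  shows "perp (hd os) d" "arm os d \<noteq> 0"
proof -
  obtain d' os' where os: "os = d' # os'" using dr(2) by (cases os) auto
  have "d' = v \<or> direction_of d' = Horizontal"
    using drifting_orientations[OF dr(1), of d'] os by auto
  then show "perp (hd os) d" using v dr(1) t unfolding os by (auto simp: perp_def vertical_def)
  show "arm os d \<noteq> 0" using v dr(1) t unfolding os by (cases os') (auto simp: vertical_def)
qed

text \<open>The parts are proved together: fresh far vertices make each square a proper ear, and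
  \<open>free_end\<close> provides the degrees for its increment. The condition on \<open>f\<close>
  guards only the last conjunct, so the graph parts can be used where no index is in play.\<close>

lemma walk_graph:
  assumes v: "vertical v" and dr: "drifting v os"
  shows "simple_graph (chain_edges (walk c os)) \<and>
    two_connected (\<Union>(chain_edges (walk c os))) (chain_edges (walk c os)) \<and>
    free_end (chain_edges (walk c os)) os (hd (walk c os)) \<and>
    (sym_pos f \<longrightarrow> TI f (chain_edges (walk c os)) = walk_value f os)"
  using dr
proof (induction os)
  case Nil
  then show ?case by simp
next
  case (Cons d os)
  show ?case
  proof (cases "os = []")
    case True
    let ?E = "sides c \<union> sides (attach d c)"
    have E: "chain_edges (walk c (d # os)) = ?E" using True by (auto simp: chain_edges_def)
    obtain e where e: "perp d e" using ex_perp by blast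
    have e': "perp d (opp e)" using e by simp
    have pq: "{corner c d e, corner c d (opp e)} \<in> sides c" using sides_corner[OF e, of c] by auto
    note ear = simple_graph_sides pq fresh_sides[OF e] fresh_sides[OF e'] corner_neq(1)[OF e]
    have "simple_graph ?E" "two_connected (\<Union>?E) ?E"
      unfolding sides_attach_ear[OF e order_refl]
      using simple_graph_ear[OF ear] two_connected_ear[OF two_connected_sides ear] by auto
    then show ?thesis unfolding E using free_end_domino TI_domino True by auto
  next
    case False
    let ?E = "chain_edges (walk c os)" and ?c = "hd (walk c os)"
    have "drifting v os" using drifting_tl Cons.prems False by blast
    from Cons.IH[OF this] have E: "simple_graph ?E" and tc: "two_connected (\<Union>?E) ?E"
      and fe: "free_end ?E os ?c" and TI: "sym_pos f \<Longrightarrow> TI f ?E = walk_value f os" by auto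
    have sub: "sides ?c \<subseteq> ?E" unfolding chain_edges_def by (rule UN_upper) simp
    have fresh: "corner (attach d ?c) d e \<notin> \<Union>?E" if "perp d e" for e
      using drifting_fresh_corner[OF v Cons.prems False that, of _ c] by (auto simp: chain_edges_def)
    obtain e where e: "perp d e" using ex_perp by blast
    have e': "perp d (opp e)" using e by simp
    have pq: "{corner ?c d e, corner ?c d (opp e)} \<in> ?E" using sub sides_corner[OF e, of ?c] by auto
    note ear = E pq fresh[OF e] fresh[OF e'] corner_neq(1)[OF e]
    have "simple_graph (?E \<union> sides (attach d ?c))"
      "two_connected (\<Union>(?E \<union> sides (attach d ?c))) (?E \<union> sides (attach d ?c))"
      unfolding sides_attach_ear[OF e sub]
      using simple_graph_ear[OF ear] two_connected_ear[OF tc ear] by auto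
    moreover have "free_end (?E \<union> sides (attach d ?c)) (d # os) (attach d ?c) \<and>
      (sym_pos f \<longrightarrow> TI f (?E \<union> sides (attach d ?c)) = walk_value f os + gain f os d)"
    proof (cases "d = hd os")
      case True
      show ?thesis
        using free_end_straight[OF E sub fe True False fresh] TI_straight[OF E sub fe True _ e fresh] TI
          True perp_set[OF e]
        by (simp add: gain_def)
    next
      case t: False
      have p: "perp (hd os) d" "arm os d \<noteq> 0"
        using drifting_turn[OF v Cons.prems False t] by auto
      show ?thesis
        using free_end_turn[OF E sub fe refl p fresh False] TI_turn[OF E sub fe refl p fresh] TI t
        by (simp add: gain_def)
    qed
    moreover have "walk_value f (d # os) = walk_value f os + gain f os d"
      using False by (cases os) auto
    ultimately show ?thesis unfolding chain_edges_walk by simp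
  qed
qed

section \<open>Interior faces\<close>

lemma segment_coordinates:
  fixes x x' y y' :: real
  shows "x \<le> x' \<Longrightarrow> closed_segment (x, y) (x', y) = {x..x'} \<times> {y}"
    and "y \<le> y' \<Longrightarrow> closed_segment (x, y) (x, y') = {x} \<times> {y..y'}"
proof -
  have const: "(1 - u) * p + u * p = p" for u p :: real by (simp add: algebra_simps)
  have "closed_segment (x, y) (x', y) = (\<lambda>t. (t, y)) ` closed_segment x x'"
    unfolding closed_segment_def by (auto simp: const)
  then show "closed_segment (x, y) (x', y) = {x..x'} \<times> {y}" if "x \<le> x'"
    using that by (auto simp: closed_segment_eq_real_ivl)
  have "closed_segment (x, y) (x, y') = Pair x ` closed_segment y y'"
    unfolding closed_segment_def by (auto simp: const)
  then show "closed_segment (x, y) (x, y') = {x} \<times> {y..y'}" if "y \<le> y'"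
    using that by (auto simp: closed_segment_eq_real_ivl)
qed

lemma hull_side:
  "convex hull (embed ` {(x, y), (x + 1, y)}) = {real_of_int x..real_of_int x + 1} \<times> {real_of_int y}"
  "convex hull (embed ` {(x, y), (x, y + 1)}) = {real_of_int x} \<times> {real_of_int y..real_of_int y + 1}"
  by (simp_all add: embed_def segment_convex_hull[symmetric] segment_coordinates)

lemma drawing_sides:
  "(a, b) \<in> drawing (sides (x, y)) \<longleftrightarrow> real_of_int x \<le> a \<and> a \<le> real_of_int x + 1 \<and>
     real_of_int y \<le> b \<and> b \<le> real_of_int y + 1 \<and>
     (a = real_of_int x \<or> a = real_of_int x + 1 \<or> b = real_of_int y \<or> b = real_of_int y + 1)"
  unfolding drawing_def sides.simps
  using hull_side(1)[of x y] hull_side(1)[of x "y + 1"] hull_side(2)[of x y] hull_side(2)[of "x + 1" y]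
  by (simp del: image_insert) argo

lemma drawing_chain_edges: "drawing (chain_edges cs) = (\<Union>c\<in>set cs. drawing (sides c))"
  by (auto simp: drawing_def chain_edges_def)

lemma unit_square_drawing: "unit_square c \<inter> drawing (sides c') = {}"
proof -
  obtain x y x' y' where c: "c = (x, y)" "c' = (x', y')" by (cases c; cases c')
  show ?thesis unfolding c by (auto simp: drawing_sides simp del: sides.simps)
qed

lemma unit_square_properties:
  "open (unit_square c)" "connected (unit_square c)" "bounded (unit_square c)" "unit_square c \<noteq> {}"
  by (cases c; auto intro!: open_Times convex_connected convex_Times bounded_Times)+

lemma frontier_unit_square: "frontier (unit_square c) \<subseteq> drawing (sides c)"
proof -
  obtain x y where c: "c = (x, y)" by (cases c)
  let ?Q = "{real_of_int x..real_of_int x + 1} \<times> {real_of_int y..real_of_int y + 1}"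
  have "closure (unit_square c) \<subseteq> ?Q"
    unfolding c by (rule closure_minimal) (auto intro: closed_Times)
  then have "frontier (unit_square c) \<subseteq> ?Q - unit_square c"
    using unit_square_properties(1)[of c] by (auto simp: frontier_def interior_open)
  also have "\<dots> \<subseteq> drawing (sides c)" unfolding c by (auto simp: drawing_sides simp del: sides.simps)
  finally show ?thesis .
qed

text \<open>A connected set that contains the square and more meets its frontier, and the frontier
  is drawn.\<close>

lemma unit_square_component:
  assumes "c \<in> set cs"
  shows "unit_square c \<in> components (- drawing (chain_edges cs))"
  unfolding in_components_maximal
proof (intro conjI allI impI)
  show "unit_square c \<noteq> {}" "connected (unit_square c)" by (rule unit_square_properties)+
  show "unit_square c \<subseteq> - drawing (chain_edges cs)"
    using unit_square_drawing unfolding drawing_chain_edges by blast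
  fix D assume D: "D \<noteq> {} \<and> unit_square c \<subseteq> D \<and> D \<subseteq> - drawing (chain_edges cs) \<and> connected D"
  have "D \<inter> frontier (unit_square c) = {}"
    using D frontier_unit_square[of c] assms unfolding drawing_chain_edges by blast
  then have "D - unit_square c = {}"
    using connected_Int_frontier[of D "unit_square c"] D unit_square_properties(4)[of c] by auto
  then show "D = unit_square c" using D by auto
qed

text \<open>Rows are grouped into blocks \<open>lo..hi\<close> because a horizontal line at integer
  height meets the closed squares of two adjacent rows; convexity of each single row would not
  control such a line.\<close>

definition hconvex :: "cell set \<Rightarrow> bool" where
  "hconvex K \<longleftrightarrow> (\<forall>lo hi x1 y1 x2 y2 m. (x1, y1) \<in> K \<longrightarrow> (x2, y2) \<in> K \<longrightarrow>
     {y1, y2} \<subseteq> {lo..hi} \<longrightarrow> x1 \<le> m \<longrightarrow> m \<le> x2 \<longrightarrow> (\<exists>y\<in>{lo..hi}. (m, y) \<in> K))"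

lemma ray_unbounded: "\<not> bounded ({..a::real} \<times> {b::real})" "\<not> bounded ({a..} \<times> {b})"
proof -
  have "\<exists>t\<le>a. B < \<bar>t\<bar>" "\<exists>t\<ge>a. B < \<bar>t\<bar>" for B
    by (rule exI[of _ "- \<bar>a\<bar> - \<bar>B\<bar> - 1"], linarith) (rule exI[of _ "\<bar>a\<bar> + \<bar>B\<bar> + 1"], linarith)
  then have "\<not> bounded {..a}" "\<not> bounded {a..}"
    by (auto simp: bounded_iff not_le)
  then have "\<not> bounded (fst ` ({..a} \<times> {b}))" "\<not> bounded (fst ` ({a..} \<times> {b}))"
    by (simp_all add: fst_image_times)
  then show "\<not> bounded ({..a::real} \<times> {b::real})" "\<not> bounded ({a..} \<times> {b})"
    using bounded_fst by blast+
qed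

text \<open>A point outside all squares escapes to infinity along its horizontal line: squares on both
  sides of it would force, by horizontal convexity, a square containing it.\<close>

lemma interior_faces_hconvex:
  assumes K: "hconvex (set cs)"
  shows "interior_faces (chain_edges cs) = unit_square ` set cs"
proof (intro equalityI subsetI)
  fix F assume "F \<in> unit_square ` set cs"
  then show "F \<in> interior_faces (chain_edges cs)"
    using unit_square_component unit_square_properties(3) by (auto simp: interior_faces_def)
next
  fix F assume "F \<in> interior_faces (chain_edges cs)"
  then have F: "F \<in> components (- drawing (chain_edges cs))" "bounded F"
    by (auto simp: interior_faces_def)
  then obtain a b where z: "(a, b) \<in> F" using in_components_nonempty by fastforce
  show "F \<in> unit_square ` set cs"
  proof (cases "\<exists>c\<in>set cs. (a, b) \<in> unit_square c")
    case True
    then obtain c where c: "c \<in> set cs" "(a, b) \<in> unit_square c" by auto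
    then have "F = unit_square c"
      using components_nonoverlap[OF F(1) unit_square_component[OF c(1)]] z by auto
    then show ?thesis using c by auto
  next
    case False
    have out: "\<not> (real_of_int x \<le> a \<and> a \<le> real_of_int x + 1 \<and> real_of_int y \<le> b \<and> b \<le> real_of_int y + 1)"
      if "(x, y) \<in> set cs" for x y
    proof -
      have "(a, b) \<notin> drawing (sides (x, y))"
        using in_components_subset[OF F(1)] z that unfolding drawing_chain_edges by blast
      moreover have "(a, b) \<notin> unit_square (x, y)" using False that by blast
      ultimately show ?thesis unfolding drawing_sides by auto
    qed
    have absurd: "R \<inter> drawing (chain_edges cs) \<noteq> {}"
      if "(a, b) \<in> R" "convex R" "\<not> bounded R" for R
    proof
      assume "R \<inter> drawing (chain_edges cs) = {}"
      then have "R \<subseteq> F"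
        using components_maximal[OF F(1) convex_connected[OF that(2)]] that(1) z by auto
      then show False using F(2) that(3) bounded_subset by blast
    qed
    have "({..a} \<times> {b}) \<inter> drawing (chain_edges cs) \<noteq> {}"
      by (rule absurd) (auto intro: convex_Times simp: ray_unbounded)
    then obtain a1 x1 y1 where 1: "a1 \<le> a" "(x1, y1) \<in> set cs" "(a1, b) \<in> drawing (sides (x1, y1))"
      unfolding drawing_chain_edges by fastforce
    have "({a..} \<times> {b}) \<inter> drawing (chain_edges cs) \<noteq> {}"
      by (rule absurd) (auto intro: convex_Times simp: ray_unbounded)
    then obtain a2 x2 y2 where 2: "a \<le> a2" "(x2, y2) \<in> set cs" "(a2, b) \<in> drawing (sides (x2, y2))"
      unfolding drawing_chain_edges by fastforce
    have x: "real_of_int x1 \<le> a" "a < real_of_int x2 + 1"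
      using 1(1,3) 2(1,3) out[OF 2(2)] unfolding drawing_sides by linarith+
    have "real_of_int y1 \<le> b" "b \<le> real_of_int y1 + 1" "real_of_int y2 \<le> b" "b \<le> real_of_int y2 + 1"
      using 1(3) 2(3) unfolding drawing_sides by auto
    \<comment> \<open>The rows whose closed squares meet the line at height \<open>b\<close>: two if
      \<open>b\<close> is an integer, otherwise one.\<close>
    then have y: "{y1, y2} \<subseteq> {\<lceil>b\<rceil> - 1..\<lfloor>b\<rfloor>}" by simp linarith
    have "a < real_of_int x2"
      using out[OF 2(2)] 2 x unfolding drawing_sides by auto
    \<comment> \<open>The column of \<open>a\<close>: a closed square in this column and one of
      these rows contains the point, against \<open>out\<close>.\<close>
    then have "x1 \<le> \<lfloor>a\<rfloor>" "\<lfloor>a\<rfloor> \<le> x2" using x by linarith+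
    then obtain y where "y \<in> {\<lceil>b\<rceil> - 1..\<lfloor>b\<rfloor>}" "(\<lfloor>a\<rfloor>, y) \<in> set cs"
      using K 1(2) 2(2) y unfolding hconvex_def by meson
    then show ?thesis using out[of "\<lfloor>a\<rfloor>" y] by (auto simp: le_floor_iff; linarith)
  qed
qed

text \<open>The new cell adds one column next to that of its neighbour \<open>(x, y)\<close>, so all
  other columns are covered by old convexity from \<open>(x, y)\<close>. This needs row
  \<open>y\<close> to be in the block, which holds in an ascending walk because \<open>y\<close>
  lies between the old rows and \<open>y'\<close>.\<close>

lemma hconvex_insert:
  assumes K: "hconvex K" and z: "(x, y) \<in> K" and x': "\<bar>x' - x\<bar> \<le> 1"
    and y: "\<And>x2 y2 lo hi. (x2, y2) \<in> K \<Longrightarrow> {y', y2} \<subseteq> {lo..hi} \<Longrightarrow> y \<in> {lo..hi}"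
  shows "hconvex (insert (x', y') K)"
  unfolding hconvex_def
proof (intro allI impI)
  fix lo hi x1 y1 x2 y2 m
  assume a: "(x1, y1) \<in> insert (x', y') K" "(x2, y2) \<in> insert (x', y') K"
    "{y1, y2} \<subseteq> {lo..hi}" "x1 \<le> m" "m \<le> x2"
  have old: "\<exists>y\<in>{lo..hi}. (m, y) \<in> K"
    if "(x1, y1) \<in> K" "(x2, y2) \<in> K" "{y1, y2} \<subseteq> {lo..hi}" "x1 \<le> m" "m \<le> x2" for x1 y1 x2 y2
    using K that unfolding hconvex_def by meson
  show "\<exists>y\<in>{lo..hi}. (m, y) \<in> insert (x', y') K"
  proof (cases "m = x' \<and> y' \<in> {lo..hi} \<or> (x1, y1) \<in> K \<and> (x2, y2) \<in> K")
    case True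
    then show ?thesis using old a by blast
  next
    case False
    then consider "(x1, y1) = (x', y')" "(x2, y2) \<in> K" "m \<noteq> x'" "(x1, y1) \<notin> K"
      | "(x2, y2) = (x', y')" "(x1, y1) \<in> K" "m \<noteq> x'" "(x2, y2) \<notin> K"
      using a by auto
    then show ?thesis
    proof cases
      case 1
      then have "y \<in> {lo..hi}" using y[of x2 y2 lo hi] a by auto
      then show ?thesis using old[OF z 1(2)] 1 x' a by auto
    next
      case 2
      then have "y \<in> {lo..hi}" using y[of x1 y1 lo hi] a by auto
      then show ?thesis using old[OF 2(2) z] 2 x' a by auto
    qed
  qed
qed

section \<open>Drifting walks as general polyomino chains\<close>

lemma hconvex_walk:
  assumes "drifting Upwards os"
  shows "hconvex (set (walk c os))"
  using assms
proof (induction os)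
  case (Cons d os)
  have v: "vertical Upwards" by (simp add: vertical_def)
  obtain x y where z: "hd (walk c os) = (x, y)" by (cases "hd (walk c os)")
  obtain x' y' where z': "attach d (x, y) = (x', y')" by (cases "attach d (x, y)")
  have IH: "hconvex (set (walk c os))"
  proof (cases "os = []")
    case True
    then show ?thesis by (cases c) (auto simp: hconvex_def)
  next
    case False
    then show ?thesis using Cons drifting_tl by blast
  qed
  have low: "y2 \<le> y" if "(x2, y2) \<in> set (walk c os)" for x2 y2
  proof (cases "os = []")
    case True
    then show ?thesis using that z by auto
  next
    case False
    then have "bounded_walk Upwards os c" using bounded_walk[OF v] Cons.prems drifting_tl by blast
    then show ?thesis using that z by (auto simp: bounded_walk_def height_def Let_def)
  qed
  have "d \<in> {Rightwards, Leftwards, Upwards}"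
    using drifting_orientations[OF Cons.prems, of d] by (cases d) auto
  then have "\<bar>x' - x\<bar> \<le> 1" "y' = y \<or> y' = y + 1" using z' by auto
  moreover have "(x, y) \<in> set (walk c os)" using z hd_walk_in[of c os] by simp
  ultimately have "hconvex (insert (x', y') (set (walk c os)))"
    using low by (intro hconvex_insert[OF IH]) (auto, fastforce)
  then show ?case using z z' by simp
qed simp

lemma distinct_walk:
  assumes v: "vertical v"
  shows "drifting v os \<Longrightarrow> distinct (walk c os)"
proof (induction os)
  case (Cons d os)
  show ?case
  proof (cases "os = []")
    case True
    then show ?thesis by (cases c; cases d) auto
  next
    case False
    then show ?thesis using Cons drifting_tl drifting_fresh_cell[OF v Cons.prems False] by auto
  qed
qed simp

text \<open>Indices refer to the reversed list, where a new square goes to the end and old positions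
  are kept.\<close>

lemma adjacent_walk:
  assumes v: "vertical v"
  shows "drifting v os \<Longrightarrow> i < j \<Longrightarrow> j \<le> length os \<Longrightarrow>
    sides (rev (walk c os) ! i) \<inter> sides (rev (walk c os) ! j) \<noteq> {} \<longleftrightarrow> j = i + 1"
proof (induction os arbitrary: j)
  case (Cons d os)
  let ?w = "walk c os"
  show ?case
  proof (cases "j \<le> length os")
    case j: True
    then have "os \<noteq> []" using Cons.prems by auto
    then have "drifting v os" using Cons.prems drifting_tl by blast
    then show ?thesis using Cons.IH[of j] Cons.prems j by (simp add: nth_append)
  next
    case False
    then have j: "j = length os + 1" using Cons.prems by auto
    have i: "i < length ?w" using j Cons.prems by simp
    have nth: "rev (walk c (d # os)) ! j = attach d (hd ?w)" "rev (walk c (d # os)) ! i = rev ?w ! i"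
      using i j by (simp_all add: nth_append)
    show ?thesis
    proof (cases "os = []")
      case True
      then show ?thesis using i j unfolding nth
        by (cases c; cases d) (simp_all add: sides_inter del: sides.simps)
    next
      case False
      have "rev ?w ! i \<in> set ?w" using i by (metis length_rev nth_mem set_rev)
      then have "sides (attach d (hd ?w)) \<inter> sides (rev ?w ! i) \<noteq> {} \<longleftrightarrow> rev ?w ! i = hd ?w"
        using drifting_adjacent[OF v Cons.prems(1) False] by blast
      moreover have "rev ?w ! i = rev ?w ! length os \<longleftrightarrow> i = length os"
        using distinct_walk[OF v drifting_tl[OF Cons.prems(1) False]] i
        by (subst nth_eq_iff_index_eq) auto
      moreover have "rev ?w ! length os = hd ?w" by (simp add: rev_nth hd_conv_nth)
      ultimately show ?thesis unfolding nth using j by (auto simp: Int_commute)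
    qed
  qed
qed simp

text \<open>This serves existence, for which ascending walks suffice; a given realization that
  descends is a chain by the definition of \<open>realizes\<close>.\<close>

lemma general_polyomino_chain_walk:
  assumes "drifting Upwards os"
  shows "general_polyomino_chain (rev (walk c os))"
proof -
  have v: "vertical Upwards" by (simp add: vertical_def)
  let ?cs = "rev (walk c os)"
  have E: "chain_edges ?cs = chain_edges (walk c os)" by (simp add: chain_edges_def)
  have faces: "interior_faces (chain_edges ?cs) = unit_square ` set ?cs"
    using interior_faces_hconvex[of "walk c os"] hconvex_walk[OF assms] by (simp add: E)
  have "polyomino_system (chain_edges ?cs)"
    using faces walk_graph[OF v assms, of c "\<lambda>_ _. 0"] unfolding polyomino_system_def E simple_graph_def
    by (auto simp: chain_edges_def)
  moreover have "sides (sq ?cs i) \<inter> sides (sq ?cs j) \<noteq> {} \<longleftrightarrow> j = i + 1 \<or> i = j + 1"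
    if "i \<in> {1..length ?cs}" "j \<in> {1..length ?cs}" "i \<noteq> j" for i j
  proof (cases "i < j")
    case True
    then show ?thesis using that adjacent_walk[OF v assms, of "i - 1" "j - 1" c]
      unfolding sq_def by auto
  next
    case False
    then show ?thesis using that adjacent_walk[OF v assms, of "j - 1" "i - 1" c]
      unfolding sq_def by (auto simp: Int_commute)
  qed
  ultimately show ?thesis
    using faces distinct_walk[OF v assms, of c] unfolding general_polyomino_chain_def by auto
qed

section \<open>Links determine the walk\<close>

text \<open>The last orientation whose direction differs from the current one; \<open>v\<close> stands in when all
  squares so far have the same direction.\<close>

fun other :: "orientation \<Rightarrow> orientation list \<Rightarrow> orientation" where
  "other v (d # e # os) = (if perp d e then e else other v (e # os))"
| "other v _ = v"

definition next_link :: "orientation \<Rightarrow> orientation list \<Rightarrow> orientation \<Rightarrow> nat" where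
  "next_link v os d =
     (if os = [] \<or> \<not> perp d (hd os) then 1 else if d = other v os then 2 else 3)"

text \<open>There is one entry for each square from 2 on, hence the extra leading 1 for square 1 in
  later statements.\<close>

fun links :: "orientation \<Rightarrow> orientation list \<Rightarrow> nat list" where
  "links v [] = []"
| "links v (d # os) = next_link v os d # links v os"

text \<open>Lists run backwards, so \<open>last\<close> picks the earliest vertical step. The
  condition makes the stand-in value of \<open>other\<close> agree with the rule that a turn without
  predecessor has link 2.\<close>

definition first_vertical :: "orientation \<Rightarrow> orientation list \<Rightarrow> bool" where
  "first_vertical v os \<longleftrightarrow> filter vertical os = [] \<or> last (filter vertical os) = v"

lemma length_links [simp]: "length (links v os) = length os"
  by (induction os) auto

lemma first_vertical_tl: "first_vertical v (d # os) \<Longrightarrow> first_vertical v os"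
  by (auto simp: first_vertical_def split: if_splits)

lemma nth_walk:
  assumes "2 \<le> i" "i \<le> length os + 1"
  shows "sq (rev (walk c os)) i = attach (rev os ! (i - 2)) (sq (rev (walk c os)) (i - 1))"
  using assms
proof (induction os)
  case (Cons d os)
  show ?case
  proof (cases "i \<le> length os + 1")
    case True
    then have "i - 1 < length os + 1" "i - 2 < length os" "i - 1 - 1 < length os + 1"
      using Cons.prems by auto
    then show ?thesis using Cons.IH[OF Cons.prems(1) True] by (simp add: sq_def nth_append)
  next
    case False
    then have i: "i = length os + 2" using Cons.prems by auto
    have "rev (walk c os) ! length os = hd (walk c os)" by (simp add: rev_nth hd_conv_nth)
    then show ?thesis using i by (simp add: sq_def nth_append)
  qed
qed simp

lemma orient_walk:
  assumes "2 \<le> i" "i \<le> length os + 1"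
  shows "orient (rev (walk c os)) i = rev os ! (i - 2)"
  unfolding orient_def nth_walk[OF assms] by (rule the_equality) (auto simp: attach_inject)

lemma link_cong:
  assumes "\<And>l. 1 < l \<Longrightarrow> l \<le> k \<Longrightarrow> orient cs l = orient cs' l"
  shows "link cs k = link cs' k"
proof (cases "k \<le> 2")
  case False
  let ?J = "\<lambda>cs. {l. 1 < l \<and> l < k - 1 \<and> dir cs l \<noteq> dir cs (k - 1)}"
  have dir: "dir cs l = dir cs' l" if "1 < l" "l \<le> k" for l
    using assms[OF that] by (simp add: dir_def)
  then have J: "?J cs = ?J cs'" using False by auto
  have "orient cs (Max (?J cs')) = orient cs' (Max (?J cs'))" if "?J cs' \<noteq> {}"
  proof -
    have "finite (?J cs')" by (rule finite_subset[of _ "{..k}"]) auto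
    from Max_in[OF this that] have "1 < Max (?J cs')" "Max (?J cs') \<le> k" by auto
    then show ?thesis by (rule assms)
  qed
  then show ?thesis
    unfolding link_def Let_def J using False dir[of k] dir[of "k - 1"] assms[of k] by auto
qed (simp add: link_def)

text \<open>Positions in \<open>rev os\<close> are the square numbers diminished by 2.\<close>

lemma other_Max:
  assumes "os \<noteq> []"
  defines "J \<equiv> {p. p < length os - 1 \<and> perp (rev os ! p) (hd os)}"
  shows "(J = {} \<longrightarrow> other v os = v) \<and> (J \<noteq> {} \<longrightarrow> rev os ! Max J = other v os)"
  using assms(1) unfolding J_def
proof (induction os)
  case (Cons d os)
  show ?case
  proof (cases os)
    case (Cons e os')
    let ?J = "\<lambda>os. {p. p < length os - 1 \<and> perp (rev os ! p) (hd os)}"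
    have nth: "rev (d # os) ! p = rev os ! p" if "p < length os" for p
      using that by (simp add: nth_append)
    have top: "rev os ! (length os - 1) = e" using Cons by (simp add: nth_append)
    show ?thesis
    proof (cases "perp d e")
      case True
      have "Max (?J (d # os)) = length os - 1"
      proof (rule Max_eqI)
        show "length os - 1 \<in> ?J (d # os)"
          using nth[of "length os - 1"] top perp_sym[OF True] Cons by simp
      qed auto
      moreover have "length os - 1 \<in> ?J (d # os)"
        using nth[of "length os - 1"] top perp_sym[OF True] Cons by simp
      ultimately show ?thesis using True Cons nth[of "length os - 1"] top by auto
    next
      case False
      then have same: "perp x d \<longleftrightarrow> perp x e" for x by (auto simp: perp_def)
      have J: "?J (d # os) = ?J os"
      proof (intro set_eqI iffI)
        fix p assume p: "p \<in> ?J (d # os)"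
        then have "p < length os" "perp (rev os ! p) e" using nth same Cons by auto
        moreover from this have "p \<noteq> length os - 1" using top by auto
        ultimately show "p \<in> ?J os" using Cons by simp
      next
        fix p assume "p \<in> ?J os"
        then show "p \<in> ?J (d # os)" using nth[of p] same Cons by auto
      qed
      have fin: "finite (?J os)" by (rule finite_subset[of _ "{..length os}"]) auto
      have "other v (d # os) = other v os" using False Cons by simp
      moreover have "rev (d # os) ! Max (?J os) = rev os ! Max (?J os)" if "?J os \<noteq> {}"
      proof -
        have "Max (?J os) < length os" using Max_in[OF fin that] by auto
        then show ?thesis by (rule nth)
      qed
      ultimately show ?thesis using Cons.IH Cons unfolding J by simp
    qed
  qed simp
qed simp

text \<open>The index set in \<open>link\<close> is the one of \<open>other_Max\<close> shifted by
  2. If it is empty, the value 2 is forced by \<open>link\<close>, and the stand-in value of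
  \<open>other\<close> must be shown to give 2 as well.\<close>

lemma link_last:
  assumes last: "last (d # os) = Rightwards" and fv: "first_vertical v (d # os)"
  shows "link (rev (walk c (d # os))) (length os + 2) = next_link v os d"
proof (cases "os = []")
  case False
  let ?cs = "rev (walk c (d # os))" and ?n = "length os"
  let ?J = "{l. 1 < l \<and> l < ?n + 1 \<and> dir ?cs l \<noteq> dir ?cs (?n + 1)}"
  let ?P = "{p. p < ?n - 1 \<and> perp (rev os ! p) (hd os)}"
  have or: "orient ?cs l = rev os ! (l - 2)" if "1 < l" "l \<le> ?n + 1" for l
  proof -
    have "l - 2 < ?n" using that False by (cases os) auto
    then show ?thesis using orient_walk[of l "d # os" c] that by (simp add: nth_append)
  qed
  have new: "orient ?cs (?n + 2) = d"
    using orient_walk[of "?n + 2" "d # os" c] by (simp add: nth_append)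
  have cur: "orient ?cs (?n + 1) = hd os"
    using or[of "?n + 1"] False by (simp add: rev_nth hd_conv_nth Suc_le_eq)
  have J: "?J = (\<lambda>p. p + 2) ` ?P"
  proof (intro set_eqI iffI)
    fix l assume l: "l \<in> ?J"
    then have "l - 2 \<in> ?P" using or[of l] cur by (auto simp: dir_def perp_def)
    then show "l \<in> (\<lambda>p. p + 2) ` ?P" using l by (intro image_eqI[of _ _ "l - 2"]) auto
  next
    fix l assume "l \<in> (\<lambda>p. p + 2) ` ?P"
    then obtain p where p: "l = p + 2" "p \<in> ?P" by auto
    then show "l \<in> ?J" using or[of l] cur by (auto simp: dir_def perp_def)
  qed
  have fin: "finite ?P" by (rule finite_subset[of _ "{..?n}"]) auto
  have Max: "orient ?cs (Max ?J) = other v os" if "?P \<noteq> {}"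
  proof -
    have "Max ?J = Max ?P + 2" unfolding J
      by (rule mono_Max_commute[symmetric, OF _ fin that]) (auto simp: mono_def)
    moreover have "orient ?cs (Max ?P + 2) = rev os ! Max ?P"
      using Max_in[OF fin that] or[of "Max ?P + 2"] by auto
    moreover have "rev os ! Max ?P = other v os" using other_Max[OF False, of v] that by blast
    ultimately show ?thesis by simp
  qed
  \<comment> \<open>Without an earlier perpendicular step all steps share the direction of the
    first, which is horizontal; so \<open>d\<close> is the first vertical step.\<close>
  have none: "d = other v os" if P: "?P = {}" and t: "perp d (hd os)"
  proof -
    have dirs: "direction_of e = direction_of (hd os)" if e: "e \<in> set os" for e
    proof -
      have "e \<in> set (rev os)" using e by simp
      then obtain p where p: "p < ?n" "e = rev os ! p" unfolding in_set_conv_nth by auto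
      have "rev os ! (?n - 1) = hd os" using False by (simp add: rev_nth hd_conv_nth)
      then show ?thesis using p P by (cases "p = ?n - 1") (auto simp: perp_def)
    qed
    have "last os = Rightwards" using last False by simp
    then have "direction_of (hd os) = Horizontal" using dirs[of "last os"] last_in_set[OF False] by simp
    then have "direction_of e = Horizontal" if "e \<in> set os" for e using dirs[OF that] by simp
    then have "filter vertical os = []" by (auto simp: filter_empty_conv vertical_def)
    moreover have "vertical d"
      using t \<open>direction_of (hd os) = Horizontal\<close>
      by (cases "direction_of d") (auto simp: perp_def vertical_def)
    ultimately have "d = v" using fv by (simp add: first_vertical_def)
    then show ?thesis using other_Max[OF False, of v] P by simp
  qed
  have "link ?cs (?n + 2) = (if direction_of d = direction_of (hd os) then 1
      else if ?J = {} \<or> d = orient ?cs (Max ?J) then 2 else 3)"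
    using False unfolding link_def Let_def by (simp add: dir_def new[simplified] cur[simplified])
  also have "\<dots> = next_link v os d"
  proof (cases "?P = {}")
    case True
    then show ?thesis using none False unfolding J by (auto simp: next_link_def perp_def)
  next
    case ne: False
    then show ?thesis using Max False unfolding J by (auto simp: next_link_def perp_def)
  qed
  finally show ?thesis .
qed (simp add: link_def next_link_def)

lemma map_link_walk:
  assumes "os \<noteq> []" "last os = Rightwards" "first_vertical v os"
  shows "map (link (rev (walk c os))) [1..<length os + 2] = 1 # rev (links v os)"
  using assms
proof (induction os)
  case (Cons d os)
  let ?cs = "rev (walk c (d # os))"
  have IH: "map (link (rev (walk c os))) [1..<length os + 2] = 1 # rev (links v os)"
  proof (cases "os = []")
    case True
    then show ?thesis by (simp add: link_def)
  next
    case False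
    then show ?thesis using Cons first_vertical_tl by auto
  qed
  have "link ?cs k = link (rev (walk c os)) k" if "k \<in> set [1..<length os + 2]" for k
  proof (rule link_cong)
    fix l assume "1 < l" "l \<le> k"
    then show "orient ?cs l = orient (rev (walk c os)) l"
      using that orient_walk[of l "d # os" c] orient_walk[of l os c]
      by (auto simp: nth_append simp del: upt_Suc)
  qed
  then have old: "map (link ?cs) [1..<length os + 2] = map (link (rev (walk c os))) [1..<length os + 2]"
    by (rule map_cong[OF refl])
  have upt: "[1..<length (d # os) + 2] = [1..<length os + 2] @ [length os + 2]" by simp
  show ?case unfolding upt map_append old IH
    using link_last[OF Cons.prems(2,3), of c] by (simp del: walk.simps)
qed simp

section \<open>Recovering a walk from its links\<close>

fun reversal_free :: "orientation list \<Rightarrow> bool" where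
  "reversal_free (d # e # os) = ((perp d e \<or> d = e) \<and> reversal_free (e # os))"
| "reversal_free _ = True"

lemma reversal_free_hd: "reversal_free (d # os) \<Longrightarrow> os \<noteq> [] \<Longrightarrow> perp d (hd os) \<or> d = hd os"
  by (cases os) auto

lemma perp_other:
  "vertical v \<Longrightarrow> os \<noteq> [] \<Longrightarrow> last os = Rightwards \<Longrightarrow> perp (hd os) (other v os)"
  by (induction v os rule: other.induct) (auto simp: perp_def vertical_def)

text \<open>Going backwards is excluded, so link 1 means straight on, while links 2 and 3 pick
  \<open>other v os\<close> and its opposite, the only two perpendicular orientations.\<close>

lemma links_inject:
  assumes v: "vertical v"
  shows "links v os = links v os' \<Longrightarrow> last os = Rightwards \<Longrightarrow> last os' = Rightwards \<Longrightarrow>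
    reversal_free os \<Longrightarrow> reversal_free os' \<Longrightarrow> os = os'"
proof (induction os arbitrary: os')
  case Nil
  then show ?case by (cases os') auto
next
  case (Cons d os)
  then obtain d' os'' where os': "os' = d' # os''" by (cases os') auto
  show ?case
  proof (cases "os = []")
    case True
    then have "os'' = []" using Cons.prems(1) os' by (cases os'') auto
    then show ?thesis using True Cons.prems os' by simp
  next
    case False
    then have "os'' \<noteq> []" using arg_cong[OF Cons.prems(1), of length] os' by auto
    then have "os = os''"
      using Cons.IH[of os''] Cons.prems False unfolding os'
      by (cases os; cases os'') auto
    moreover have "d = d'"
    proof -
      have "last os = Rightwards" using Cons.prems(2) False by simp
      then have o: "perp (hd os) (other v os)" using perp_other[OF v False] by simp
      have "next_link v os d = next_link v os d'" using Cons.prems(1) \<open>os = os''\<close> os' by simp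
      moreover have "perp d (hd os) \<or> d = hd os" "perp d' (hd os) \<or> d' = hd os"
        using reversal_free_hd Cons.prems(4,5) False unfolding os' \<open>os = os''\<close>[symmetric] by blast+
      moreover have "e = other v os \<or> e = opp (other v os)" if "perp e (hd os)" for e
        using perp_cases[OF o perp_sym[OF that]] .
      ultimately show ?thesis using False by (auto simp: next_link_def split: if_splits)
    qed
    ultimately show ?thesis using os' by simp
  qed
qed

lemma walk_exhaust:
  "ws \<noteq> [] \<Longrightarrow> (\<And>i. Suc i < length ws \<Longrightarrow> \<exists>d. ws ! i = attach d (ws ! Suc i)) \<Longrightarrow> \<exists>c os. ws = walk c os"
proof (induction ws)
  case (Cons w ws)
  show ?case
  proof (cases "ws = []")
    case True
    then have "w # ws = walk w []" by simp
    then show ?thesis by blast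
  next
    case False
    have "\<exists>d. ws ! i = attach d (ws ! Suc i)" if "Suc i < length ws" for i
      using Cons.prems(2)[of "Suc i"] that by simp
    then obtain c os where ws: "ws = walk c os" using Cons.IH False by blast
    obtain d where "w = attach d (hd ws)"
      using Cons.prems(2)[of 0] False by (auto simp: hd_conv_nth)
    then have "w # ws = walk c (d # os)" using ws by simp
    then show ?thesis by blast
  qed
qed simp

text \<open>A reversal would return to the last square but one.\<close>

lemma reversal_free_distinct: "distinct (walk c os) \<Longrightarrow> reversal_free os"
proof (induction os rule: reversal_free.induct)
  case (1 d e os)
  have "attach d (attach e (hd (walk c os))) \<noteq> hd (walk c os)" using 1(2) by auto
  then have "d \<noteq> opp e" by auto
  then show ?case using 1 direction_of_eq_iff[of d e] by (auto simp: perp_def)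
qed auto

lemma realizes_walk:
  assumes r: "realizes cs ls" and n: "2 \<le> length ls"
  shows "\<exists>c os. cs = rev (walk c os) \<and> os \<noteq> [] \<and> last os = Rightwards \<and> reversal_free os"
proof -
  have "length ls = length cs" using r by (auto simp: realizes_def simp del: upt_Suc)
  then have chain: "general_polyomino_chain cs" and len: "2 \<le> length cs"
    and two: "sq cs 2 = attach Rightwards (sq cs 1)"
    using r n unfolding realizes_def by auto
  have adj: "sides (sq cs (i + 1)) \<inter> sides (sq cs i) \<noteq> {}" "sq cs (i + 1) \<noteq> sq cs i"
    if "1 \<le> i" "i < length cs" for i
  proof -
    have "\<forall>i\<in>{1..length cs}. \<forall>j\<in>{1..length cs}. i \<noteq> j \<longrightarrow>
        (sides (sq cs i) \<inter> sides (sq cs j) \<noteq> {} \<longleftrightarrow> j = i + 1 \<or> i = j + 1)"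
      using chain unfolding general_polyomino_chain_def by (elim conjE)
    from bspec[OF bspec[OF this, of "i + 1"], of i]
    show "sides (sq cs (i + 1)) \<inter> sides (sq cs i) \<noteq> {}" using that by simp
    have "distinct cs" using chain by (simp add: general_polyomino_chain_def)
    then show "sq cs (i + 1) \<noteq> sq cs i" using that by (simp add: sq_def nth_eq_iff_index_eq)
  qed
  have "\<exists>d. rev cs ! i = attach d (rev cs ! Suc i)" if i: "Suc i < length (rev cs)" for i
  proof -
    let ?k = "length cs - Suc i"
    have k: "1 \<le> ?k" "?k < length cs" using i by auto
    have "\<exists>d. sq cs (?k + 1) = attach d (sq cs ?k)"
      using sides_inter_attach[of "sq cs ?k" "sq cs (?k + 1)"] adj[OF k] by (metis Int_commute)
    moreover have "rev cs ! i = sq cs (?k + 1)" "rev cs ! Suc i = sq cs ?k"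
      using i by (simp_all add: rev_nth sq_def)
    ultimately show ?thesis by simp
  qed
  moreover have "rev cs \<noteq> []" using len by auto
  ultimately obtain c os where w: "rev cs = walk c os" using walk_exhaust by blast
  then have cs: "cs = rev (walk c os)" by (metis rev_rev_ident)
  then have os: "os \<noteq> []" using len by auto
  have "last os = Rightwards"
    using nth_walk[of 2 os c] two os attach_inject
    unfolding cs by (simp add: rev_nth last_conv_nth Suc_le_eq)
  moreover have "reversal_free os"
    using chain cs reversal_free_distinct[of c os] by (simp add: general_polyomino_chain_def)
  ultimately show ?thesis using cs os by blast
qed

lemma reversal_free_drifting: "vertical v \<Longrightarrow> drifting v os \<Longrightarrow> reversal_free os"
  using distinct_walk reversal_free_distinct by blast

lemma first_vertical_drifting:
  assumes "drifting v os"
  shows "first_vertical v os"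
proof -
  have "last (filter vertical os) = v" if ne: "filter vertical os \<noteq> []"
  proof -
    have "last (filter vertical os) \<in> set (filter vertical os)" by (rule last_in_set[OF ne])
    then show ?thesis
      using drifting_orientations[OF assms, of "last (filter vertical os)"] by (auto simp: vertical_def)
  qed
  then show ?thesis by (auto simp: first_vertical_def)
qed

lemma realizes_drifting:
  assumes "drifting Upwards os"
  shows "realizes (rev (walk c os)) (1 # rev (links Upwards os))"
proof -
  have os: "os \<noteq> []" "last os = Rightwards" using drifting_nonempty last_drifting assms by blast+
  have "sq (rev (walk c os)) 2 = attach Rightwards (sq (rev (walk c os)) 1)"
    using nth_walk[of 2 os c] os by (simp add: rev_nth last_conv_nth Suc_le_eq)
  then show ?thesis
    using general_polyomino_chain_walk[OF assms] map_link_walk[OF os first_vertical_drifting[OF assms]]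
    by (simp add: realizes_def)
qed

text \<open>The walk is given as a family in \<open>v\<close> because the vertical orientation is
  read off from the realization.\<close>

lemma realizes_unique:
  assumes r: "realizes cs ls" and n: "2 \<le> length ls"
    and ls: "\<And>v. vertical v \<Longrightarrow> drifting v (os v) \<and> ls = 1 # rev (links v (os v))"
  shows "\<exists>v c. vertical v \<and> cs = rev (walk c (os v))"
proof -
  obtain c os' where cs: "cs = rev (walk c os')" and os': "os' \<noteq> []" "last os' = Rightwards"
    "reversal_free os'" using realizes_walk[OF r n] by blast
  \<comment> \<open>If the chain has no vertical square, either choice of \<open>v\<close> would
    do.\<close>
  define v where "v = (if filter vertical os' = [] then Upwards else last (filter vertical os'))"
  have v: "vertical v" "first_vertical v os'"
    using last_in_set[of "filter vertical os'"]
    by (auto simp: v_def first_vertical_def vertical_def)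
  have "1 # rev (links v os') = ls"
    using r map_link_walk[OF os'(1,2) v(2), of c] by (simp add: realizes_def cs)
  then have "links v os' = links v (os v)" using ls[OF v(1)] by simp
  then have "os' = os v"
    using links_inject[OF v(1)] os' ls[OF v(1)] last_drifting reversal_free_drifting[OF v(1)] by blast
  then show ?thesis using v cs by blast
qed

section \<open>Parity correction\<close>

text \<open>In this form second letters matter only through being S or not, so exchanging a C and a
  T visibly preserves the constraints.\<close>

lemma compressed_sequence_iff:
  "compressed_sequence as \<longleftrightarrow> as \<noteq> [] \<and> (\<forall>i<length as. fst (as ! i) \<noteq> T) \<and> fst (as ! 0) = S \<and>
     (\<forall>i. i + 1 < length as \<longrightarrow> (fst (as ! (i + 1)) = S \<longleftrightarrow> snd (as ! i) = S))"
proof -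
  have mem: "a \<in> {SS, SC, CS, CC, ST, CT} \<longleftrightarrow> fst a \<noteq> T" for a :: action
    by (cases a; cases "fst a"; cases "snd a") auto
  have first: "a \<in> {SS, SC, ST} \<longleftrightarrow> fst a = S" for a :: action
    by (cases a; cases "fst a"; cases "snd a") auto
  have all: "set as \<subseteq> {SS, SC, CS, CC, ST, CT} \<longleftrightarrow> (\<forall>i<length as. fst (as ! i) \<noteq> T)"
    unfolding subset_iff mem by (metis in_set_conv_nth)
  have CT: "x \<in> {C, T} \<longleftrightarrow> x \<noteq> S" for x by (cases x) auto
  have "(fst (as ! (i + 1)) = S \<longleftrightarrow> snd (as ! i) = S) \<longleftrightarrow>
      (snd (as ! i) = S \<longrightarrow> fst (as ! (i + 1)) = S) \<and>
      (snd (as ! i) \<in> {C, T} \<longrightarrow> fst (as ! (i + 1)) = C)"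
    if "i + 1 < length as" "\<forall>i<length as. fst (as ! i) \<noteq> T" for i
    using that unfolding CT by (cases "fst (as ! (i + 1))") auto
  then show ?thesis
    unfolding compressed_sequence_def all first by (auto simp: hd_conv_nth)
qed

text \<open>The number of changes of direction in the expanded action, which is also the increment
  of the counter in Algorithm 1.\<close>

definition turns :: "action \<Rightarrow> nat" where
  "turns a = (case snd a of S \<Rightarrow> 0 | C \<Rightarrow> 1 | T \<Rightarrow> 2)"

definition weight :: "action list \<Rightarrow> nat \<Rightarrow> nat" where
  "weight as k = (\<Sum>l<k. turns (as ! l))"

text \<open>The weight leaves out action \<open>k\<close> itself. A T adds two, so the parity is the
  one that Algorithm 1 tests after its update.\<close>

definition parity_correct :: "action list \<Rightarrow> nat \<Rightarrow> bool" where
  "parity_correct as n \<longleftrightarrow> (\<forall>k<n. snd (as ! k) = T \<longrightarrow> even (weight as k))"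

lemma action_value_sum:
  "as \<noteq> [] \<Longrightarrow>
    action_value f as = (\<Sum>k<length as. if k = 0 then c_init f (as ! k) else g f (as ! k))"
  by (cases as) (simp_all add: action_value_def sum.lessThan_Suc_shift sum_list_sum_nth atLeast0LessThan del: sum.lessThan_Suc)

lemma length_expand: "length (expand as) = (\<Sum>k<length as. if as ! k \<in> {ST, CT} then 3 else 1)"
proof -
  have "length (expand as) = sum_list (map (\<lambda>a. if a \<in> {ST, CT} then 3 else 1) as)"
    unfolding expand_def length_concat by (auto intro!: arg_cong[of _ _ sum_list])
  then show ?thesis by (simp add: sum_list_sum_nth atLeast0LessThan)
qed

lemma num_squares_expand:
  assumes "set as \<subseteq> {SS, SC, CS, CC, ST, CT}"
  shows "num_squares as = 2 + length (expand as)"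
  using assms by (induction as) (auto simp: num_squares_def expand_def)

lemma sum_swap:
  fixes \<phi> :: "nat \<Rightarrow> 'b \<Rightarrow> 'a :: comm_monoid_add"
  assumes ji: "j < i" "i < n" "n \<le> length as"
    and eq: "\<phi> j x + \<phi> i y = \<phi> j (as ! j) + \<phi> i (as ! i)"
  shows "(\<Sum>k<n. \<phi> k (as[j := x, i := y] ! k)) = (\<Sum>k<n. \<phi> k (as ! k))"
proof -
  let ?R = "{..<n} - {j} - {i}"
  have split: "(\<Sum>k<n. h k) = h j + h i + (\<Sum>k\<in>?R. h k)" for h :: "nat \<Rightarrow> 'a"
    using ji by (simp add: sum.remove[of "{..<n}" j] sum.remove[of "{..<n} - {j}" i] add.assoc)
  have "(\<Sum>k\<in>?R. \<phi> k (as[j := x, i := y] ! k)) = (\<Sum>k\<in>?R. \<phi> k (as ! k))"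
    by (intro sum.cong) auto
  then show ?thesis
    unfolding split[of "\<lambda>k. \<phi> k (as[j := x, i := y] ! k)"] split[of "\<lambda>k. \<phi> k (as ! k)"]
    using ji eq by simp
qed

lemma weight_between:
  assumes "j \<le> i" "\<And>k. j \<le> k \<Longrightarrow> k < i \<Longrightarrow> snd (as ! k) \<noteq> C"
  shows "even (weight as i) \<longleftrightarrow> even (weight as j)"
  using assms
proof (induction i rule: dec_induct)
  case (step i)
  then have "even (turns (as ! i))" by (cases "snd (as ! i)") (auto simp: turns_def)
  then show ?case using step by (simp add: weight_def)
qed simp

definition parity_invariant :: "action list \<Rightarrow> nat \<Rightarrow> nat \<times> action list \<Rightarrow> bool" where
  "parity_invariant as i s \<longleftrightarrow> (let bs = snd s in
     compressed_sequence bs \<and> length bs = length as \<and> fst s = weight bs i \<and> parity_correct bs i \<and>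
     length (expand bs) = length (expand as) \<and> (\<forall>f. action_value f bs = action_value f as))"

text \<open>Between \<open>j\<close> and \<open>i\<close> there are only S letters, and the weight
  before \<open>j\<close> is even. Hence the T moved to \<open>j\<close> is correctly placed, and
  the total weight through \<open>i\<close> is unchanged.\<close>

lemma parity_invariant_swap:
  assumes inv: "parity_invariant as i (m, bs)" and i: "i < length as"
    and T: "snd (bs ! i) = T" and odd: "odd (weight bs i)"
  defines "j \<equiv> Max {j. j < i \<and> snd (bs ! j) = C}"
  shows "parity_invariant as (i + 1) (m + 2, bs[j := (fst (bs ! j), T), i := (fst (bs ! i), C)])"
proof -
  have bs: "compressed_sequence bs" "length bs = length as" "m = weight bs i" "parity_correct bs i"
    "length (expand bs) = length (expand as)" "\<And>f. action_value f bs = action_value f as"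
    using inv by (auto simp: parity_invariant_def)
  let ?J = "{j. j < i \<and> snd (bs ! j) = C}"
  let ?bs = "bs[j := (fst (bs ! j), T), i := (fst (bs ! i), C)]"
  have fin: "finite ?J" by (rule finite_subset[of _ "{..i}"]) auto
  have "?J \<noteq> {}"
  proof
    assume "?J = {}"
    then have "even (weight bs i) \<longleftrightarrow> even (weight bs 0)" by (intro weight_between) auto
    then show False using odd by (simp add: weight_def)
  qed
  from Max_in[OF fin this] have j: "j < i" "snd (bs ! j) = C" by (auto simp: j_def)
  have no_C: "snd (bs ! k) \<noteq> C" if k: "j < k" "k < i" for k
  proof
    assume "snd (bs ! k) = C"
    then have "k \<le> j" unfolding j_def using k by (intro Max_ge[OF fin]) simp
    then show False using k by simp
  qed
  \<comment> \<open>Past \<open>j\<close> no C occurs, so such a T would see the same odd parity as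
    \<open>i\<close>, against correctness so far.\<close>
  have no_T: "snd (bs ! k) \<noteq> T" if k: "j < k" "k < i" for k
  proof
    assume "snd (bs ! k) = T"
    then have "even (weight bs k)" using bs(4) k by (auto simp: parity_correct_def)
    moreover have "even (weight bs i) \<longleftrightarrow> even (weight bs k)"
      using k no_C by (intro weight_between) auto
    ultimately show False using odd by simp
  qed
  have "even (weight bs i) \<longleftrightarrow> even (weight bs (j + 1))"
    using j no_C by (intro weight_between) auto
  then have even: "even (weight bs j)" using odd j by (simp add: weight_def turns_def)
  have nth: "?bs ! k = (if k = i then (fst (bs ! i), C) else if k = j then (fst (bs ! j), T) else bs ! k)"
    if "k < length bs" for k
    using that j i bs(2) by (auto simp: nth_list_update)
  have fstT: "fst (bs ! k) = S \<or> fst (bs ! k) = C" if "k < length bs" for k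
    using bs(1) that unfolding compressed_sequence_iff by (cases "fst (bs ! k)") auto
  have pat: "fst (?bs ! k) = fst (bs ! k)" "snd (?bs ! k) = S \<longleftrightarrow> snd (bs ! k) = S"
    if "k < length bs" for k
    using that j T by (auto simp: nth)
  have c: "compressed_sequence ?bs"
    using bs(1) unfolding compressed_sequence_iff
    by (auto simp: pat simp del: list_update_overwrite)
  have F: "bs ! j = (fst (bs ! j), C)" "bs ! i = (fst (bs ! i), T)"
    using j T by (simp_all add: prod_eq_iff)
  have Fj: "fst (bs ! j) = S \<or> fst (bs ! j) = C" "fst (bs ! i) = S \<or> fst (bs ! i) = C"
    using fstT j i bs(2) by auto
  have F0: "j = 0 \<Longrightarrow> fst (bs ! j) = S" using bs(1) by (simp add: compressed_sequence_iff)
  have len: "i < length bs" using i bs(2) by simp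
  have val: "action_value f ?bs = action_value f bs" for f
  proof -
    let ?h = "\<lambda>k a. if k = 0 then c_init f a else g f a"
    \<comment> \<open>For either first letter, T exceeds C by \<open>g f CS + g f TT\<close>, and
      \<open>c_init\<close> obeys the same rule for first letter S, the only one possible at
      position 0.\<close>
    have "?h j (fst (bs ! j), T) + ?h i (fst (bs ! i), C) = ?h j (fst (bs ! j), C) + ?h i (fst (bs ! i), T)"
      using Fj F0 j by (auto simp: g_def)
    then have "?h j (fst (bs ! j), T) + ?h i (fst (bs ! i), C) = ?h j (bs ! j) + ?h i (bs ! i)"
      by (simp only: F[symmetric])
    from sum_swap[where \<phi> = ?h, OF j(1) len order_refl this] show ?thesis
      using c bs(1) by (simp add: action_value_sum compressed_sequence_def)
  qed
  have ex: "length (expand ?bs) = length (expand bs)"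
  proof -
    let ?h = "\<lambda>k a. if a \<in> {ST, CT} then 3 else 1 :: nat"
    have "?h j (fst (bs ! j), T) + ?h i (fst (bs ! i), C) = ?h j (bs ! j) + ?h i (bs ! i)"
      unfolding F(1)[THEN arg_cong[of _ _ "?h j"]] F(2)[THEN arg_cong[of _ _ "?h i"]]
      using Fj by auto
    from sum_swap[where \<phi> = ?h, OF j(1) len order_refl this] show ?thesis
      by (simp add: length_expand)
  qed
  have w: "weight ?bs (i + 1) = weight bs (i + 1)"
    unfolding weight_def
    by (rule sum_swap[where \<phi> = "\<lambda>_. turns", OF j(1)]) (use len j T in \<open>auto simp: turns_def\<close>)
  have "parity_correct ?bs (i + 1)"
    unfolding parity_correct_def
  proof (intro allI impI)
    fix k assume k: "k < i + 1" "snd (?bs ! k) = T"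
    have "k \<noteq> i" using k len by (auto simp: nth)
    moreover have "\<not> (j < k \<and> k < i)" using k no_T[of k] len by (auto simp: nth)
    ultimately have kj: "k \<le> j" using k by auto
    have "weight ?bs k = weight bs k"
      unfolding weight_def using kj j by (intro sum.cong) auto
    moreover have "even (weight bs k)"
    proof (cases "k = j")
      case False
      then have "snd (bs ! k) = T" using k kj j by auto
      then show ?thesis using bs(4) kj j by (auto simp: parity_correct_def)
    qed (use even in simp)
    ultimately show "even (weight ?bs k)" by simp
  qed
  then show ?thesis
    using c bs val ex w T unfolding parity_invariant_def by (simp add: weight_def turns_def)
qed

lemma parity_invariant_step:
  assumes inv: "parity_invariant as i s" and i: "i < length as"
  shows "parity_invariant as (i + 1) (parity_step i s)"
proof -
  obtain m bs where s: "s = (m, bs)" by (cases s)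
  let ?m = "m + (if bs ! i \<in> {SC, CC} then 1 else 0) + (if bs ! i \<in> {ST, CT} then 2 else 0)"
  have bs: "compressed_sequence bs" "length bs = length as" "m = weight bs i" "parity_correct bs i"
    using inv by (auto simp: parity_invariant_def s)
  have "fst (bs ! i) \<noteq> T" using bs(1,2) i by (simp add: compressed_sequence_iff)
  then have m: "?m = m + turns (bs ! i)"
    by (cases "bs ! i"; cases "fst (bs ! i)"; cases "snd (bs ! i)") (auto simp: turns_def)
  show ?thesis
  proof (cases "snd (bs ! i) = T \<and> odd m")
    case True
    then have "turns (bs ! i) = 2" by (simp add: turns_def)
    then show ?thesis
      using parity_invariant_swap[of as i m bs] inv i True bs(3)
      unfolding s parity_step.simps Let_def m by simp
  next
    case False
    then have cond: "\<not> (snd (bs ! i) = T \<and> odd (m + turns (bs ! i)))" by (auto simp: turns_def)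
    have "parity_step i s = (m + turns (bs ! i), bs)"
      unfolding s parity_step.simps Let_def m if_not_P[OF cond] ..
    moreover have "parity_correct bs (i + 1)"
      using bs(3,4) False by (auto simp: parity_correct_def less_Suc_eq)
    ultimately show ?thesis
      using inv bs(3) by (simp add: parity_invariant_def s weight_def)
  qed
qed

lemma parity_correction_properties:
  assumes "compressed_sequence as"
  defines "bs \<equiv> parity_correction as"
  shows "compressed_sequence bs" "parity_correct bs (length bs)"
    "length (expand bs) = length (expand as)" "action_value f bs = action_value f as"
proof -
  have "i \<le> length as \<Longrightarrow> parity_invariant as i (fold parity_step [0..<i] (0, as))" for i
  proof (induction i)
    case 0
    then show ?case using assms(1) by (simp add: parity_invariant_def weight_def parity_correct_def)
  next
    case (Suc i)
    then show ?case using parity_invariant_step[of as i] by simp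
  qed
  from this[of "length as"] show "compressed_sequence bs" "parity_correct bs (length bs)"
    "length (expand bs) = length (expand as)" "action_value f bs = action_value f as"
    by (auto simp: parity_invariant_def bs_def parity_correction_def Let_def)
qed

section \<open>Simulation of action sequences\<close>

text \<open>The T case is meant for a horizontal last step: two vertical steps and a horizontal step back.\<close>

definition extend :: "orientation \<Rightarrow> orientation list \<Rightarrow> action \<Rightarrow> orientation list" where
  "extend v os a = (case snd a of S \<Rightarrow> hd os # os | C \<Rightarrow> other v os # os
     | T \<Rightarrow> opp (hd os) # v # v # os)"

definition straight :: "orientation list \<Rightarrow> bool" where
  "straight os \<longleftrightarrow> hd os = hd (tl os)"

lemma drifting_straight: "drifting v os \<Longrightarrow> drifting v (hd os # os)"
  using drifting_orientations[of v os "hd os"] by (cases os) auto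

lemma other_horizontal:
  "drifting v os \<Longrightarrow> direction_of (hd os) = Horizontal \<Longrightarrow> other v os = v"
proof (induction v os rule: other.induct)
  case (1 v d e os)
  then show ?case using drifting_orientations[of v "d # e # os" e] by (auto simp: perp_def)
qed auto

text \<open>After a vertical step \<open>other v os\<close> is horizontal. The step before was then
  \<open>v\<close> or that very orientation, which is what \<open>drifting\<close> demands.\<close>

lemma drifting_zigzag:
  assumes v: "vertical v" and dr: "drifting v os"
  shows "drifting v (other v os # os)"
proof (cases "direction_of (hd os) = Horizontal")
  case True
  then show ?thesis using other_horizontal[OF dr] dr by (cases os) auto
next
  case False
  have o: "perp (hd os) (other v os)"
    using perp_other[OF v drifting_nonempty[OF dr] last_drifting[OF dr]] .
  then have h: "direction_of (other v os) = Horizontal"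
    using False by (cases "direction_of (other v os)"; cases "direction_of (hd os)") (auto simp: perp_def)
  obtain d os' where os: "os = d # os'" using drifting_nonempty[OF dr] by (cases os) auto
  have d: "d = v" using drifting_orientations[OF dr, of d] False os by auto
  then obtain e os'' where os': "os' = e # os''" using dr v os by (cases os') (auto simp: vertical_def)
  have "e = v \<or> e = other v os"
    using drifting_orientations[OF dr, of e] v d unfolding os os' by (auto simp: perp_def vertical_def)
  then show ?thesis using dr d h unfolding os os' by auto
qed

lemma extend_properties:
  assumes v: "vertical v" and dr: "drifting v os"
    and a: "fst a \<noteq> T" "snd a = T \<Longrightarrow> direction_of (hd os) = Horizontal"
  shows "drifting v (extend v os a)"
    and "1 # rev (links v (extend v os a)) = (1 # rev (links v os)) @
      map (\<lambda>b. if b = TT then 3 else if snd b = S then 1 else 2) (expand [a])"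
    and "direction_of (hd (extend v os a)) = direction_of (hd os) \<longleftrightarrow> even (turns a)"
    and "straight (extend v os a) \<longleftrightarrow> snd a = S"
    and "2 \<le> length (extend v os a)"
proof -
  have ne: "os \<noteq> []" using drifting_nonempty[OF dr] .
  have o: "perp (hd os) (other v os)" using perp_other[OF v ne last_drifting[OF dr]] .
  then have zig: "next_link v os (other v os) = 2" using ne perp_sym by (simp add: next_link_def)
  obtain F L where FL: "a = (F, L)" by (cases a)
  have ex: "expand [a] = (if L = T then [(F, C), CS, TT] else [a])"
    using a(1) unfolding FL by (cases F; cases L) (auto simp: expand_def)
  have T: "direction_of (hd os) = Horizontal \<and> perp v (hd os) \<and> other v os = v" if "snd a = T"
    using a(2)[OF that] other_horizontal[OF dr] v by (auto simp: perp_def vertical_def)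
  \<comment> \<open>Seen from the two vertical steps, the last differing orientation is the old
    horizontal one, so stepping back gets link 3.\<close>
  have U: "other v (v # v # os) = hd os" if "snd a = T"
    using T[OF that] ne by (cases os) auto
  have VV: "drifting v (v # v # os)" using dr ne by (cases os) auto
  show "drifting v (extend v os a)"
    using drifting_straight[OF dr] drifting_zigzag[OF v dr] T VV
    by (cases "snd a") (auto simp: extend_def)
  show "1 # rev (links v (extend v os a)) = (1 # rev (links v os)) @
      map (\<lambda>b. if b = TT then 3 else if snd b = S then 1 else 2) (expand [a])"
  proof (cases L)
    case T': T
    then have s: "snd a = T" using FL by simp
    have "next_link v os v = 2" using zig T[OF s] by simp
    moreover have "next_link v (v # os) v = 1" by (simp add: next_link_def)
    moreover have "next_link v (v # v # os) (opp (hd os)) = 3"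
      using T[OF s] U[OF s] by (simp add: next_link_def perp_sym)
    ultimately show ?thesis using T' s a(1) unfolding ex by (auto simp: extend_def FL)
  qed (use zig a(1) in \<open>auto simp: expand_def extend_def FL next_link_def\<close>)
  show "direction_of (hd (extend v os a)) = direction_of (hd os) \<longleftrightarrow> even (turns a)"
    using o by (cases "snd a") (auto simp: extend_def turns_def perp_def)
  show "straight (extend v os a) \<longleftrightarrow> snd a = S"
    using o T by (cases "snd a") (auto simp: extend_def straight_def)
  show "2 \<le> length (extend v os a)"
    using ne by (cases "snd a"; cases os) (auto simp: extend_def)
qed

text \<open>The zigzag step keeps the walk drifting, so \<open>drifting_turn\<close> applies to
  it.\<close>

lemma arm_other:
  assumes "vertical v" "drifting v os"
  shows "arm os (other v os) \<noteq> 0"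
proof -
  have ne: "os \<noteq> []" using drifting_nonempty assms(2) by blast
  have "perp (hd os) (other v os)" using perp_other[OF assms(1) ne last_drifting[OF assms(2)]] .
  then have "other v os \<noteq> hd os" by auto
  then show ?thesis using drifting_turn(2)[OF assms(1) drifting_zigzag[OF assms] ne] by simp
qed

section \<open>Local contributions as increments along a walk\<close>

context
  fixes f :: "nat \<Rightarrow> nat \<Rightarrow> real"
  assumes f: "sym_pos f"
begin

lemma f_sym: "f 3 2 = f 2 3" "f 4 2 = f 2 4" "f 4 3 = f 3 4"
  using f by (simp_all add: sym_pos_def)

text \<open>Both shared vertices have degree 3 after a straight step; after a turn one has degree 3
  and the other 4.\<close>

lemma gain_straight:
  assumes v: "vertical v" and os: "2 \<le> length os" and dr: "drifting v os"
  shows "gain f os (hd os) = (if straight os then g f SS else g f CS)"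
proof -
  obtain d e os' where s: "os = d # e # os'" using os by (cases os; cases "tl os") auto
  show ?thesis
  proof (cases "d = e")
    case True
    obtain p where p: "perp d p" using ex_perp by blast
    have "base_degree os q = 3" for q using True by (simp add: s base_degree_def)
    moreover have "card {q. perp d q} = 2" using perp_set[OF p] by simp
    ultimately show ?thesis using True by (simp add: gain_def s straight_def g_def f_sym)
  next
    case False
    then have p: "perp d e" using reversal_free_drifting[OF v dr] unfolding s by auto
    show ?thesis
      using False by (simp add: gain_def s straight_def perp_set[OF p] g_def f_sym base_degree_def)
  qed
qed

lemma gain_zigzag:
  assumes v: "vertical v" and os: "2 \<le> length os" and dr: "drifting v os"
  shows "gain f os (other v os) = (if straight os then g f SC else g f CC)"
proof -
  obtain d e os' where s: "os = d # e # os'" using os by (cases os; cases "tl os") auto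
  have o: "perp d (other v os)"
    using perp_other[OF v drifting_nonempty[OF dr] last_drifting[OF dr]] s by simp
  then have ne: "other v os \<noteq> d" by auto
  show ?thesis
  proof (cases "d = e")
    case True
    have "other v os = other v (e # os')" using True by (simp add: s)
    moreover have "drifting v (e # os')" using dr by (simp add: s)
    \<comment> \<open>The value 4 would require \<open>arm\<close> to vanish one square earlier on
      this side, which \<open>arm_other\<close> excludes because \<open>other\<close> is unchanged
      by the straight step.\<close>
    ultimately have "arm os (other v os) = 3" using arm_other[OF v] True by (simp add: s)
    moreover have "base_degree os q = 3" for q using True by (simp add: s base_degree_def)
    ultimately show ?thesis
      using True ne by (simp add: gain_def s straight_def g_def f_sym del: arm.simps)
  next
    case False
    then have p: "perp d e" using reversal_free_drifting[OF v dr] unfolding s by auto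
    then show ?thesis
      using False by (simp add: gain_def s straight_def g_def f_sym base_degree_def)
  qed
qed

text \<open>The side turned to is the inner side of the earlier turn, where that turn created a
  vertex of degree 4: \<open>arm\<close> is 4 there, and \<open>base_degree\<close> is 3 on the
  opposite side.\<close>

lemma gain_back:
  assumes "perp v d"
  shows "gain f (v # v # d # os) (opp d) = g f TT"
proof -
  have "v \<noteq> d" "opp d \<noteq> v" using assms by auto
  then show ?thesis by (simp add: gain_def g_def f_sym base_degree_def)
qed

lemma walk_value_Cons: "os \<noteq> [] \<Longrightarrow> walk_value f (d # os) = walk_value f os + gain f os d"
  by (cases os) auto

lemma walk_value_back:
  assumes v: "vertical v" and dr: "drifting v os" and h: "direction_of (hd os) = Horizontal"
  shows "walk_value f (opp (hd os) # v # v # os) = walk_value f (v # os) + g f CS + g f TT"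
proof -
  have ne: "os \<noteq> []" using drifting_nonempty[OF dr] .
  have p: "perp v (hd os)" using v h by (simp add: perp_def vertical_def)
  have dv: "drifting v (v # os)" using dr ne by (cases os) auto
  have "\<not> straight (v # os)" using p by (auto simp: straight_def)
  then have "gain f (v # os) v = g f CS"
    using gain_straight[OF v _ dv] ne by (cases os) auto
  moreover have "gain f (v # v # os) (opp (hd os)) = g f TT"
    using gain_back p ne by (cases os) auto
  ultimately show ?thesis using ne by (simp add: walk_value_Cons)
qed

lemma walk_value_extend:
  assumes v: "vertical v" and os: "2 \<le> length os" and dr: "drifting v os"
    and a: "fst a \<noteq> T" "snd a = T \<Longrightarrow> direction_of (hd os) = Horizontal"
    and match: "fst a = S \<longleftrightarrow> straight os"
  shows "walk_value f (extend v os a) = walk_value f os + g f a"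
proof -
  have ne: "os \<noteq> []" using os by auto
  obtain F L where FL: "a = (F, L)" by (cases a)
  have F: "F = (if straight os then S else C)" using a(1) match FL by (cases F) auto
  show ?thesis
  proof (cases L)
    case T
    then have h: "direction_of (hd os) = Horizontal" using a FL by simp
    have "gain f os v = (if straight os then g f SC else g f CC)"
      using gain_zigzag[OF v os dr] other_horizontal[OF dr h] by simp
    then show ?thesis
      using walk_value_back[OF v dr h] ne T F
      by (simp add: extend_def FL walk_value_Cons g_def)
  qed (use gain_straight[OF v os dr] gain_zigzag[OF v os dr] ne F in
      \<open>simp_all add: extend_def FL walk_value_Cons\<close>)
qed

lemma walk_value_extend_init:
  assumes v: "vertical v" and a: "fst a = S"
  shows "walk_value f (extend v [Rightwards] a) = c_init f a"
proof -
  have p: "perp Rightwards v" "v \<noteq> Rightwards" using v by (auto simp: perp_def vertical_def)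
  have s: "{e. perp Rightwards e} = {v, opp v}" by (rule perp_set[OF p(1)])
  have dr: "drifting v [Rightwards]" "direction_of (hd [Rightwards]) = Horizontal" by simp_all
  have turn: "walk_value f [v, Rightwards] = c_init f SC"
    using p by (simp add: gain_def base_degree_def f_sym)
  obtain L where "a = (S, L)" using a by (cases a) auto
  then show ?thesis
    using p turn walk_value_back[OF v dr]
    by (cases L) (simp_all add: extend_def gain_def base_degree_def f_sym s)
qed

text \<open>Only second letters steer the walk. First letters record whether the last step was
  straight, which selects the local contribution; even weight at a T guarantees the horizontal
  position that \<open>extend\<close> presupposes.\<close>

lemma simulation:
  assumes v: "vertical v"
  defines "run \<equiv> foldl (extend v) [Rightwards]"
  shows "(as = [] \<or> compressed_sequence as) \<Longrightarrow> parity_correct as (length as) \<Longrightarrow>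
    drifting v (run as) \<and> 1 # rev (links v (run as)) = actions_to_links (expand as) \<and>
    (direction_of (hd (run as)) = Horizontal \<longleftrightarrow> even (weight as (length as))) \<and>
    (as \<noteq> [] \<longrightarrow> (straight (run as) \<longleftrightarrow> snd (last as) = S) \<and> 2 \<le> length (run as) \<and>
      walk_value f (run as) = action_value f as)"
proof (induction as rule: rev_induct)
  case Nil
  then show ?case
    by (simp add: run_def next_link_def actions_to_links_def expand_def weight_def)
next
  case (snoc a as)
  have c: "compressed_sequence (as @ [a])" using snoc.prems(1) by simp
  let ?n = "length as"
  have nth: "(as @ [a]) ! k = as ! k" if "k < ?n" for k using that by (simp add: nth_append)
  have w: "weight (as @ [a]) k = weight as k" if "k \<le> ?n" for k
    unfolding weight_def using that by (intro sum.cong) (auto simp: nth_append)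
  have wS: "weight (as @ [a]) (Suc ?n) = weight as ?n + turns a"
    using w[of ?n] by (simp add: weight_def)
  have par: "parity_correct as ?n" and T: "snd a = T \<Longrightarrow> even (weight as ?n)"
    using snoc.prems(2) w nth by (auto simp: parity_correct_def less_Suc_eq)
  have a: "fst a \<noteq> T" using c unfolding compressed_sequence_iff by auto
  have prev: "as = [] \<or> compressed_sequence as"
    using c unfolding compressed_sequence_iff by (auto simp: nth_append split: if_splits)
  have match: "fst a = S \<longleftrightarrow> snd (last as) = S" if "as \<noteq> []"
  proof -
    have "?n - 1 + 1 < length (as @ [a])" using that by simp
    then have "fst ((as @ [a]) ! (?n - 1 + 1)) = S \<longleftrightarrow> snd ((as @ [a]) ! (?n - 1)) = S"
      using c unfolding compressed_sequence_iff by blast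
    then show ?thesis using that by (simp add: nth_append last_conv_nth)
  qed
  have init: "fst a = S" if "as = []" using c that by (simp add: compressed_sequence_iff)
  note IH = snoc.IH[OF prev par]
  have dr: "drifting v (run as)" and h: "snd a = T \<Longrightarrow> direction_of (hd (run as)) = Horizontal"
    using IH T by auto
  have run: "run (as @ [a]) = extend v (run as) a" by (simp add: run_def)
  note ext = extend_properties[OF v dr a h]
  have "1 # rev (links v (run (as @ [a]))) = actions_to_links (expand (as @ [a]))"
  proof -
    have "expand (as @ [a]) = expand as @ expand [a]" by (simp add: expand_def)
    moreover have "1 # rev (links v (run as)) = actions_to_links (expand as)" using IH by blast
    ultimately show ?thesis unfolding run using ext(2) by (simp add: actions_to_links_def)
  qed
  moreover have "direction_of (hd (run (as @ [a]))) = Horizontal \<longleftrightarrow>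
      even (weight (as @ [a]) (length (as @ [a])))"
    using ext(3) IH unfolding run
    by (cases "direction_of (hd (run as))"; cases "direction_of (hd (extend v (run as) a))")
       (simp_all add: wS)
  moreover have "walk_value f (run (as @ [a])) = action_value f (as @ [a])"
  proof (cases "as = []")
    case True
    then show ?thesis
      using walk_value_extend_init[OF v init] by (simp add: run_def action_value_def)
  next
    case False
    have "walk_value f (extend v (run as) a) = walk_value f (run as) + g f a"
      by (rule walk_value_extend[OF v _ dr a h]) (use IH False match in auto)
    then show ?thesis using IH False unfolding run by (simp add: action_value_def)
  qed
  ultimately show ?case using ext unfolding run by simp
qed

end

theorem theorem4p1:
  fixes f :: "nat \<Rightarrow> nat \<Rightarrow> real" and as :: "action list"
  assumes "\<forall>x\<ge>1. \<forall>y\<ge>1. f x y = f y x"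
    and "compressed_sequence as"
  defines "ls \<equiv> actions_to_links (expand (parity_correction as))"
  shows "globally_realizable ls \<and> length ls = num_squares as \<and>
    (\<forall>cs. realizes cs ls \<longrightarrow>
       length cs = num_squares as \<and> TI f (chain_edges cs) = action_value f as)"
proof -
  define bs where "bs = parity_correction as"
  \<comment> \<open>Both vertical orientations are simulated, since the realization decides which
    one occurs.\<close>
  define os where "os v = foldl (extend v) [Rightwards] bs" for v
  have f: "sym_pos f" using assms(1) by (simp add: sym_pos_def)
  note bs = parity_correction_properties[OF assms(2), folded bs_def]
  have ne: "bs \<noteq> []" using bs(1) by (simp add: compressed_sequence_def)
  have sim: "drifting v (os v) \<and> ls = 1 # rev (links v (os v)) \<and>
      walk_value f (os v) = action_value f as" if "vertical v" for v
    using simulation[OF f that, of bs] bs ne by (simp add: os_def ls_def bs_def)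
  have up: "vertical Upwards" by (simp add: vertical_def)
  have "globally_realizable ls"
    unfolding globally_realizable_def
    using realizes_drifting[of "os Upwards"] sim[OF up] by metis
  moreover have len: "length ls = num_squares as"
    using bs(3) num_squares_expand[of as] assms(2)
    by (simp add: ls_def actions_to_links_def bs_def compressed_sequence_def)
  moreover have "length cs = num_squares as \<and> TI f (chain_edges cs) = action_value f as"
    if r: "realizes cs ls" for cs
  proof
    have "length ls = length cs" using r by (auto simp: realizes_def simp del: upt_Suc)
    then show "length cs = num_squares as" using len by simp
    have "2 \<le> length ls" by (simp add: ls_def actions_to_links_def)
    then obtain v c where vc: "vertical v" "cs = rev (walk c (os v))"
      using realizes_unique[OF r, of os] sim by blast
    have "chain_edges cs = chain_edges (walk c (os v))" by (simp add: vc(2) chain_edges_def)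
    then show "TI f (chain_edges cs) = action_value f as"
      using walk_graph[OF vc(1), of "os v" c f] sim[OF vc(1)] f by simp
  qed
  ultimately show ?thesis by blast
qed

end
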